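(* For every $\omega\in\mathbb{C}$ with $\operatorname{Re}\omega>-\tfrac12$, $$\nu_\omega = -\frac{1}{(\omega+1)^2}+\frac{\gamma}{\omega+1}-\frac12\int_{-\infty}^{+\infty}\frac{\zeta\big(\tfrac12\pm ix\big)}{\big(\tfrac12\pm ix+\omega\big)\cosh \pi x}\,dx,$$ where $\nu_\omega=\sum_{j=2}^{\infty}(-1)^j\frac{\zeta(j)}{j+\omega}$. The identity holds for either choice of the sign $\pm$ (the same sign being taken in the numerator and in the denominator).
   Context: $\zeta$ denotes the Riemann zeta function (analytically continued) and $\gamma$ is Euler's constant. For a complex number $\omega$ that is not an integer $\le -2$, $\nu_\omega$ denotes the sum of the (conditionally convergent) series $$\nu_\omega=\sum_{j=2}^{\infty}(-1)^j\frac{\zeta(j)}{j+\omega}=\lim_{N\to\infty}\sum_{j=2}^{N}(-1)^j\frac{\zeta(j)}{j+\omega}.$$ *)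

theory Defs
  imports "HOL-Complex_Analysis.Complex_Analysis"
begin

text \<open>
  The holomorphic continuation of the Dirichlet series to the plane without the point 1 is unique
  by the identity theorem. The pole at 1 gets the dummy value 0, which makes the description
  determine a total function.
\<close>

definition riemann_zeta :: "complex \<Rightarrow> complex" where
  "riemann_zeta = (THE f. f holomorphic_on - {1} \<and>
     (\<forall>s. Re s > 1 \<longrightarrow> (\<lambda>n. 1 / of_nat (Suc n) powr s) sums f s) \<and> f 1 = 0)"

definition nu_partial :: "complex \<Rightarrow> nat \<Rightarrow> complex" where
  "nu_partial \<omega> N = (\<Sum>j=2..N. (-1) ^ j * (riemann_zeta (of_nat j) / (of_nat j + \<omega>)))"

text \<open>
  The series converges only conditionally, so its sum is the limit of the partial sums in their
  natural order. It is meaningful when \<open>\<omega>\<close> is not an integer \<open>\<le> -2\<close>.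
\<close>

definition nu :: "complex \<Rightarrow> complex" where
  "nu \<omega> = lim (nu_partial \<omega>)"

definition nu_integrand :: "real \<Rightarrow> complex \<Rightarrow> real \<Rightarrow> complex" where
  "nu_integrand \<sigma> \<omega> x =
     riemann_zeta (1/2 + of_real \<sigma> * \<i> * of_real x) /
       ((1/2 + of_real \<sigma> * \<i> * of_real x + \<omega>) * of_real (cosh (pi * x)))"

end

theory Submission
  imports Defs
begin

text \<open>
  Write \<open>s = 1/2 \<plusminus> \<i> u\<close>. On the critical line \<open>\<zeta> s\<close> is the limit of the functions
  \<open>(\<Sum>n\<le>N. n powr - s) - N powr (1 - s) / (1 - s)\<close>, which grow at most linearly in \<open>s\<close>,
  so the integral in the theorem can be computed term by term. Each term reduces to the self-dual
  Fourier transform of \<open>1 / cosh\<close>, in the form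
  \<open>1/2 * (\<integral>u. y powr - s / cosh (\<pi> u)) = 1 / (1 + y)\<close>. Since \<open>1 / (s + \<omega>)\<close> is the integral of
  \<open>x powr (s + \<omega> - 1)\<close> over \<open>0 < x < 1\<close>, inserting the factor \<open>1 / (s + \<omega>)\<close> gives
  \<open>T y = \<integral>x. x powr \<omega> / (x + y)\<close>, and partial fractions of
  \<open>1 / ((1 - s) (s + \<omega>))\<close> treat the last term. On the other side, expanding \<open>\<zeta> j\<close> gives
  \<open>\<nu> = (\<Sum>n. 1 / (n (\<omega> + 1)) - T n)\<close>. The two expressions differ by harmonic numbers minus a
  logarithm, which produces Euler's constant, and by \<open>N * T N / (\<omega> + 1)\<close>, which tends to
  \<open>1 / (\<omega> + 1)\<^sup>2\<close>.

  That \<open>riemann_zeta\<close> denotes a function with the defining properties needs the continuation to the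
  whole plane, which is obtained by moving the half plane of holomorphy to the left by 1 at a time.
\<close>

subsection \<open>Continuation of the zeta function\<close>

lemma norm_of_nat_powr: "n > 0 \<Longrightarrow> norm (of_nat n powr s :: complex) = real n powr Re s"
  using norm_powr_real_powr[of "of_nat n" s] by (cases "n = 0") auto

text \<open>The expression is the increment, from \<open>n\<close> to \<open>n + 1\<close>, of the
  approximation \<open>(s - 1) * (partial sum) + N powr (1 - s)\<close> to
  \<open>(s - 1) * zeta s\<close>. It is the integral of
  \<open>(s - 1) * ((n + 1) powr - s - z powr - s)\<close> over
  \<open>n \<le> z \<le> n + 1\<close>, so two mean value estimates gain one power of
  \<open>1 / n\<close> and make the increments summable for \<open>Re s > 0\<close>.\<close>

lemma zeta_approx_step:
  fixes s :: complex and n :: nat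
  assumes s: "Re s > 0" and n: "n > 0"
  shows "norm ((s - 1) * (1 / of_nat (Suc n) powr s) + of_nat (Suc n) powr (1 - s) - of_nat n powr (1 - s))
    \<le> norm (s - 1) * norm s * real n powr (- Re s - 1)"
proof -
  define b where "b = (of_nat (Suc n) :: complex)"
  define S where "S = closed_segment (of_nat n) b"
  have S_eq: "S = of_real ` {real n..real (Suc n)}"
    unfolding S_def b_def using closed_segment_of_real[of "real n" "real (Suc n)", where 'a = complex]
    by (simp add: closed_segment_eq_real_ivl del: of_nat_Suc)
  have conv: "convex S" unfolding S_def by simp
  have inS: "of_nat n \<in> S" "b \<in> S" unfolding S_def by auto
  have np: "z \<notin> \<real>\<^sub>\<le>\<^sub>0" "z \<noteq> 0" if "z \<in> S" for z using that n unfolding S_eq by auto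
  have dist: "norm (b - z) \<le> 1" if "z \<in> S" for z
  proof -
    obtain t where t: "z = of_real t" "real n \<le> t" "t \<le> real (Suc n)" using \<open>z \<in> S\<close> unfolding S_eq by auto
    have "b - z = of_real (real (Suc n) - t)" using t unfolding b_def by simp
    then show ?thesis using t by (metis abs_of_nonneg add.commute add_le_cancel_left diff_ge_0_iff_ge le_diff_eq diff_le_eq norm_of_real of_nat_Suc)
  qed
  define B where "B = norm s * real n powr (- Re s - 1)"
  have bd: "norm (- s * z powr (- s - 1)) \<le> B" if "z \<in> S" for z
  proof -
    obtain t where t: "z = of_real t" "real n \<le> t" "t \<le> real (Suc n)" using \<open>z \<in> S\<close> unfolding S_eq by auto
    have "norm (z powr (- s - 1)) = t powr (- Re s - 1)"
      using norm_powr_real_powr[of z "-s-1"] t n by auto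
    also have "\<dots> \<le> real n powr (- Re s - 1)"
      using t n s by (intro powr_mono2') auto
    finally show ?thesis unfolding B_def by (simp add: norm_mult mult_left_mono)
  qed
  have B0: "B \<ge> 0" unfolding B_def by simp
  have 1: "norm (b powr (- s) - z powr (- s)) \<le> B" if z: "z \<in> S" for z
  proof -
    have "norm (b powr (- s) - z powr (- s)) \<le> B * norm (b - z)"
      by (rule field_differentiable_bound[OF conv, where f' = "\<lambda>z. - s * z powr (- s - 1)"])
         (use np bd z inS in \<open>auto intro!: derivative_eq_intros simp: powr_diff\<close>)
    also have "\<dots> \<le> B * 1" using dist[OF z] B0 by (intro mult_left_mono) auto
    finally show ?thesis by simp
  qed
  \<comment> \<open>The linear term makes the derivative of \<open>\<phi>\<close> vanish at
    \<open>b\<close>, so that the first estimate controls it on the whole segment. The increment of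
    \<open>\<phi>\<close> is the quantity to be bounded.\<close>
  define \<phi> where "\<phi> = (\<lambda>z. (s - 1) * z * b powr (- s) + z powr (1 - s))"
  have "norm (\<phi> b - \<phi> (of_nat n)) \<le> (norm (s - 1) * B) * norm (b - of_nat n)"
  proof (rule field_differentiable_bound[OF conv, where f' = "\<lambda>z. (s - 1) * (b powr (- s) - z powr (- s))"])
    fix z assume z: "z \<in> S"
    show "(\<phi> has_field_derivative (s - 1) * (b powr (- s) - z powr (- s))) (at z within S)"
      unfolding \<phi>_def by (rule derivative_eq_intros refl np[OF z] | simp)+ (simp add: algebra_simps)
    show "norm ((s - 1) * (b powr (- s) - z powr (- s))) \<le> norm (s - 1) * B"
      using 1[OF z] by (simp add: norm_mult mult_left_mono)
  qed (use inS in auto)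
  also have "b - of_nat n = 1" unfolding b_def by simp
  also have "\<phi> b - \<phi> (of_nat n) = (s - 1) * (1 / b powr s) + b powr (1 - s) - of_nat n powr (1 - s)"
  proof -
    have "(s - 1) * b * b powr (- s) - (s - 1) * of_nat n * b powr (- s) = (s - 1) * b powr (- s) * (b - of_nat n)"
      by (simp add: algebra_simps)
    also have "\<dots> = (s - 1) * (1 / b powr s)" unfolding \<open>b - of_nat n = 1\<close> by (simp add: powr_minus divide_simps)
    finally show ?thesis unfolding \<phi>_def by (simp add: algebra_simps)
  qed
  finally show ?thesis unfolding b_def B_def by (simp add: mult.assoc)
qed

text \<open>The M-test of Weierstrass with real majorants that need to hold only near each point: in
  the applications the decay rate depends on the distance to the boundary of the half plane.\<close>

lemma holomorphic_suminf_local_bound: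
  fixes f :: "nat \<Rightarrow> complex \<Rightarrow> complex"
  assumes S: "open S" and hol: "\<And>n. f n holomorphic_on S"
    and bd: "\<And>x. x \<in> S \<Longrightarrow> \<exists>d>0. \<exists>h :: nat \<Rightarrow> real. summable h \<and> (\<forall>n. \<forall>y\<in>ball x d \<inter> S. norm (f n y) \<le> h n)"
  obtains g where "g holomorphic_on S" "\<And>x. x \<in> S \<Longrightarrow> (\<lambda>n. f n x) sums g x"
proof (rule series_differentiable_comparison_complex[OF S, of f])
  show "f n field_differentiable at x" if "x \<in> S" for n x
    using hol[of n] S that by (simp add: holomorphic_on_imp_differentiable_at)
  show "\<exists>d h. 0 < d \<and> summable h \<and> range h \<subseteq> \<real>\<^sub>\<ge>\<^sub>0 \<and>
      (\<forall>\<^sub>F n in sequentially. \<forall>y\<in>ball x d \<inter> S. norm (f n y) \<le> norm (h n :: complex))" if x: "x \<in> S" for x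
  proof -
    obtain d h where d: "d > 0" and h: "summable h" "\<And>n y. y \<in> ball x d \<inter> S \<Longrightarrow> norm (f n y) \<le> h n"
      using bd[OF x] by blast
    have h0: "h n \<ge> 0" for n
      using order.trans[OF norm_ge_zero h(2)[of x n]] d x by simp
    show ?thesis
      by (rule exI[of _ d], rule exI[of _ "\<lambda>n. of_real (h n)"]) (use d h h0 in \<open>auto simp: summable_of_real_iff\<close>)
  qed
next
  fix g assume g: "\<forall>x\<in>S. (\<lambda>n. f n x) sums g x \<and> g field_differentiable at x"
  then have "g holomorphic_on S"
    by (meson field_differentiable_at_within holomorphic_on_def)
  with g that show thesis by blast
qed

text \<open>Telescoping; the summand \<open>s = (s - 1) + 1\<close> is the value of the left-hand
  side at \<open>N = 0\<close>.\<close>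

lemma zeta_approx_eq_sum:
  "(s - 1) * (\<Sum>n<Suc N. 1 / of_nat (Suc n) powr s) + of_nat (Suc N) powr (1 - s) =
    s + (\<Sum>n<N. (s - 1) * (1 / of_nat (Suc (Suc n)) powr s) + of_nat (Suc (Suc n)) powr (1 - s) - of_nat (Suc n) powr (1 - s))"
  for s :: complex
proof (induction N)
  case (Suc N)
  then show ?case by (simp add: algebra_simps)
qed simp

text \<open>The increments form a locally uniformly convergent series. Its limit is
  \<open>(s - 1) * zeta s\<close> rather than \<open>zeta s\<close>; the extra factor removes the
  pole, so no point of the half plane has to be excluded.\<close>

lemma zeta_half_plane_0:
  obtains g where "g holomorphic_on {s. Re s > 0}"
    "\<And>s. Re s > 0 \<Longrightarrow> (\<lambda>N. (s - 1) * (\<Sum>n<N. 1 / of_nat (Suc n) powr s) + of_nat N powr (1 - s)) \<longlonglongrightarrow> g s"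
proof -
  define f where "f = (\<lambda>(n::nat) (s::complex). (s - 1) * (1 / of_nat (Suc (Suc n)) powr s) + of_nat (Suc (Suc n)) powr (1 - s) - of_nat (Suc n) powr (1 - s))"
  have op: "open {s. Re s > 0}" by (simp add: open_halfspace_Re_gt)
  obtain G where G: "G holomorphic_on {s. Re s > 0}" "\<And>s. s \<in> {s. Re s > 0} \<Longrightarrow> (\<lambda>n. f n s) sums G s"
  proof (rule holomorphic_suminf_local_bound[OF op, of f])
    show "f n holomorphic_on {s. Re s > 0}" for n unfolding f_def
      by (intro holomorphic_intros) (auto simp: powr_def simp del: of_nat_Suc)
    fix x :: complex assume "x \<in> {s. Re s > 0}"
    then have x: "Re x > 0" by simp
    \<comment> \<open>Half the distance from \<open>x\<close> to the boundary line: all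
      \<open>y\<close> in the ball satisfy \<open>Re y \<ge> d\<close> and
      \<open>norm y \<le> B\<close>, so one majorant serves the whole ball.\<close>
    define d where "d = Re x / 2"
    define B where "B = norm x + d"
    have B0: "B \<ge> 0" "d > 0" unfolding B_def d_def using x by auto
    have "summable (\<lambda>n. real n powr (- d - 1))" using B0 by (simp add: summable_real_powr_iff)
    then have "summable (\<lambda>n. (B + 1) * B * real (Suc n) powr (- d - 1))"
      by (intro summable_mult) (simp only: summable_Suc_iff[of "\<lambda>n. real n powr (- d - 1)"])
    moreover have "norm (f n y) \<le> (B + 1) * B * real (Suc n) powr (- d - 1)"
      if y: "y \<in> ball x d \<inter> {s. Re s > 0}" for n y
    proof -
      have "\<bar>Re (x - y)\<bar> \<le> norm (x - y)" by (rule abs_Re_le_cmod)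
      moreover have "norm (x - y) < d" using y by (simp add: dist_norm)
      ultimately have 1: "Re y \<ge> d" unfolding d_def by (simp add: abs_if split: if_splits)
      have 2: "norm y \<le> B" unfolding B_def using \<open>norm (x - y) < d\<close>
        using norm_triangle_ineq3[of x y] by linarith
      have 3: "norm (y - 1) \<le> B + 1" using norm_triangle_ineq4[of y 1] 2 by simp
      have "norm (f n y) \<le> norm (y - 1) * norm y * real (Suc n) powr (- Re y - 1)"
        unfolding f_def using zeta_approx_step[of y "Suc n"] y by simp
      also have "\<dots> \<le> (B + 1) * B * real (Suc n) powr (- d - 1)"
        using 1 2 3 B0 by (intro mult_mono powr_mono) auto
      finally show ?thesis .
    qed
    ultimately show "\<exists>d>0. \<exists>h :: nat \<Rightarrow> real. summable h \<and> (\<forall>n. \<forall>y\<in>ball x d \<inter> {s. Re s > 0}. norm (f n y) \<le> h n)"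
      using B0 by blast
  qed (rule that)
  show thesis
  proof (rule that[of "\<lambda>s. s + G s"])
    show "(\<lambda>s. s + G s) holomorphic_on {s. Re s > 0}" using G by (intro holomorphic_intros)
    fix s :: complex assume s: "Re s > 0"
    have "(\<lambda>N. s + (\<Sum>n<N. f n s)) \<longlonglongrightarrow> s + G s"
      using G(2)[of s] s by (intro tendsto_intros) (simp add: sums_def)
    then have "(\<lambda>N. (s - 1) * (\<Sum>n<Suc N. 1 / of_nat (Suc n) powr s) + of_nat (Suc N) powr (1 - s)) \<longlonglongrightarrow> s + G s"
      unfolding zeta_approx_eq_sum f_def .
    then show "(\<lambda>N. (s - 1) * (\<Sum>n<N. 1 / of_nat (Suc n) powr s) + of_nat N powr (1 - s)) \<longlonglongrightarrow> s + G s"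
      by (rule LIMSEQ_imp_Suc)
  qed
qed

text \<open>On the critical line the increments decay like \<open>n powr (- 3/2)\<close>, so
  \<open>C\<close> depends on neither \<open>s\<close> nor \<open>N\<close>. This uniformity later
  supplies the dominating function for the integral.\<close>

lemma zeta_approx_bound:
  obtains C where "C \<ge> 0" "\<And>s N. Re s = 1/2 \<Longrightarrow>
    norm ((s - 1) * (\<Sum>n<Suc N. 1 / of_nat (Suc n) powr s) + of_nat (Suc N) powr (1 - s)) \<le> norm s * (1 + C * norm (s - 1))"
proof -
  have "summable (\<lambda>n. real n powr (- 3/2))" by (simp add: summable_real_powr_iff)
  then have sm: "summable (\<lambda>n. real (Suc n) powr (- 3/2))" by (simp only: summable_Suc_iff[of "\<lambda>n. real n powr (- 3/2)"])
  define C where "C = (\<Sum>n. real (Suc n) powr (- 3/2))"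
  show thesis
  proof (rule that[of C])
    show "C \<ge> 0" unfolding C_def using sm by (intro suminf_nonneg) auto
    fix s :: complex and N :: nat assume s: "Re s = 1/2"
    have "norm (s + (\<Sum>n<N. (s - 1) * (1 / of_nat (Suc (Suc n)) powr s) + of_nat (Suc (Suc n)) powr (1 - s) - of_nat (Suc n) powr (1 - s)))
      \<le> norm s + (\<Sum>n<N. norm (s - 1) * norm s * real (Suc n) powr (- 3/2))"
    proof (rule order.trans[OF norm_triangle_ineq], rule add_left_mono, rule sum_norm_le)
      fix n
      show "norm ((s - 1) * (1 / of_nat (Suc (Suc n)) powr s) + of_nat (Suc (Suc n)) powr (1 - s) - of_nat (Suc n) powr (1 - s))
         \<le> norm (s - 1) * norm s * real (Suc n) powr (- 3/2)"
        using zeta_approx_step[of s "Suc n"] s by simp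
    qed
    also have "\<dots> = norm s + norm (s - 1) * norm s * (\<Sum>n<N. real (Suc n) powr (- 3/2))"
      by (simp add: sum_distrib_left)
    also have "\<dots> \<le> norm s + norm (s - 1) * norm s * C"
      unfolding C_def using sm by (intro add_left_mono mult_left_mono sum_le_suminf) auto
    finally show "norm ((s - 1) * (\<Sum>n<Suc N. 1 / of_nat (Suc n) powr s) + of_nat (Suc N) powr (1 - s)) \<le> norm s * (1 + C * norm (s - 1))"
      unfolding zeta_approx_eq_sum by (simp add: algebra_simps)
  qed
qed

lemma dirichlet_summable:
  fixes s :: complex assumes "Re s > 1"
  shows "summable (\<lambda>n. 1 / of_nat (Suc n) powr s)"
proof (rule summable_norm_cancel)
  have "summable (\<lambda>n. real n powr (- Re s))" using assms by (simp add: summable_real_powr_iff)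
  then have "summable (\<lambda>n. real (Suc n) powr (- Re s))" by (simp only: summable_Suc_iff[of "\<lambda>n. real n powr (- Re s)"])
  moreover have "norm (1 / of_nat (Suc n) powr s) = real (Suc n) powr (- Re s)" for n
    by (simp add: norm_divide norm_of_nat_powr powr_minus_divide del: of_nat_Suc)
  ultimately show "summable (\<lambda>n. norm (1 / of_nat (Suc n) powr s))" by simp
qed

text \<open>The correction \<open>N powr (1 - s)\<close> vanishes in the limit when
  \<open>Re s > 1\<close>, which ties the continued function back to the Dirichlet series.\<close>

lemma zeta_limit_imp_sums:
  fixes s :: complex
  assumes s: "Re s > 1" and lim: "(\<lambda>N. (s - 1) * (\<Sum>n<N. 1 / of_nat (Suc n) powr s) + of_nat N powr (1 - s)) \<longlonglongrightarrow> L"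
  shows "(\<lambda>n. 1 / of_nat (Suc n) powr s) sums (L / (s - 1))"
proof -
  have "(\<lambda>N. real N powr (1 - Re s)) \<longlonglongrightarrow> 0"
    using s by (intro tendsto_neg_powr) (auto simp: filterlim_real_sequentially)
  then have "(\<lambda>N. norm (of_nat N powr (1 - s) :: complex)) \<longlonglongrightarrow> 0"
    by (rule Lim_transform_eventually)
       (auto intro!: eventually_mono[OF eventually_gt_at_top[of 0]] simp: norm_of_nat_powr)
  then have "(\<lambda>N. of_nat N powr (1 - s) :: complex) \<longlonglongrightarrow> 0" by (simp add: tendsto_norm_zero_iff)
  moreover have "(\<lambda>N. (\<Sum>n<N. 1 / of_nat (Suc n) powr s)) \<longlonglongrightarrow> (\<Sum>n. 1 / of_nat (Suc n) powr s)"
    using dirichlet_summable[OF s] by (rule summable_LIMSEQ)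
  ultimately have "(\<lambda>N. (s - 1) * (\<Sum>n<N. 1 / of_nat (Suc n) powr s) + of_nat N powr (1 - s)) \<longlonglongrightarrow> (s - 1) * (\<Sum>n. 1 / of_nat (Suc n) powr s) + 0"
    by (intro tendsto_intros)
  with lim have "L = (s - 1) * (\<Sum>n. 1 / of_nat (Suc n) powr s)" using LIMSEQ_unique by fastforce
  moreover have "s \<noteq> 1" using s by auto
  ultimately show ?thesis using dirichlet_summable[OF s] by (simp add: summable_sums)
qed

section \<open>Binomial expansion and the shift of the half plane\<close>

text \<open>Factor by factor, \<open>norm (s + i) \<le> B + i\<close>. The right-hand side is the
  coefficient of \<open>x ^ k\<close> in \<open>(1 - x) powr (- B)\<close>, a majorant that depends
  on \<open>s\<close> only through \<open>B\<close>.\<close>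

lemma norm_gbinomial_minus_le:
  fixes s :: complex assumes "norm s \<le> B"
  shows "norm ((- s) gchoose k) \<le> (- 1) ^ k * ((- B) gchoose k)"
proof -
  have "norm ((- s) gchoose k) = (\<Prod>i<k. norm (s + of_nat i)) / fact k"
    by (simp add: gbinomial_pochhammer pochhammer_prod norm_mult norm_divide norm_power prod_norm atLeast0LessThan)
  also have "\<dots> \<le> (\<Prod>i<k. B + real i) / fact k"
  proof (intro divide_right_mono prod_mono conjI)
    fix i show "norm (s + of_nat i) \<le> B + real i" using norm_triangle_ineq[of s "of_nat i"] assms by simp
  qed auto
  also have "\<dots> = (- 1) ^ k * ((- B) gchoose k)"
    by (simp add: gbinomial_pochhammer pochhammer_prod atLeast0LessThan flip: power_mult_distrib)
  finally show ?thesis .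
qed

text \<open>The majorant is the series of \<open>(1 - 1/2) powr (- B) = 2 powr B\<close>, whose
  terms are nonnegative. Since \<open>2 * norm z \<le> 1\<close>, every term of index beyond
  \<open>K\<close> is at most \<open>(2 * norm z) ^ Suc K\<close> times the corresponding term of
  the majorant.\<close>

lemma binomial_remainder_bound:
  fixes s z :: complex
  assumes s: "norm s \<le> B" and z: "norm z \<le> 1/2"
  shows "norm ((1 + z) powr (- s) - (\<Sum>k\<le>K. ((- s) gchoose k) * z ^ k)) \<le> (2 * norm z) ^ Suc K * 2 powr B"
proof -
  define f where "f = (\<lambda>k. ((- s) gchoose k) * z ^ k)"
  define h where "h = (\<lambda>k. ((- B) gchoose k) * (- 1/2) ^ k)"
  have "norm z < 1" using z by simp
  from gen_binomial_complex[OF this, of "-s"] have f: "f sums (1 + z) powr (- s)" unfolding f_def .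
  have "h sums (1 + - 1/2) powr (- B)" unfolding h_def using gen_binomial_real[of "-1/2" "-B"] by simp
  moreover have "(1 + - 1/2 :: real) powr (- B) = 2 powr B" by (simp add: powr_minus powr_divide)
  ultimately have h: "h sums 2 powr B" by simp
  have h_eq: "h k = (- 1) ^ k * ((- B) gchoose k) * (1/2) ^ k" for k
    unfolding h_def by (simp flip: power_mult_distrib)
  have hn: "norm ((- s) gchoose k) * (1/2) ^ k \<le> h k" for k
    unfolding h_eq using norm_gbinomial_minus_le[OF s, of k] by (intro mult_right_mono) auto
  have h0: "h k \<ge> 0" for k using hn[of k] by (rule order.trans[rotated]) simp
  have fl: "norm (f (k + Suc K)) \<le> (2 * norm z) ^ Suc K * h (k + Suc K)" for k
  proof -
    have "norm z ^ (k + Suc K) = (2 * norm z) ^ (k + Suc K) * (1/2) ^ (k + Suc K)"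
      unfolding power_mult_distrib[symmetric] by simp
    moreover have "(2 * norm z) ^ (k + Suc K) \<le> (2 * norm z) ^ Suc K"
      using z by (intro power_decreasing) auto
    ultimately have "norm z ^ (k + Suc K) \<le> (2 * norm z) ^ Suc K * (1/2) ^ (k + Suc K)"
      by (metis mult_right_mono zero_le_power zero_le_divide_1_iff zero_le_numeral)
    then have "norm (f (k + Suc K)) \<le> norm ((- s) gchoose (k + Suc K)) * ((2 * norm z) ^ Suc K * (1/2) ^ (k + Suc K))"
      unfolding f_def norm_mult norm_power by (intro mult_left_mono) auto
    also have "\<dots> = (2 * norm z) ^ Suc K * (norm ((- s) gchoose (k + Suc K)) * (1/2) ^ (k + Suc K))"
      by (rule mult.left_commute)
    also have "\<dots> \<le> (2 * norm z) ^ Suc K * h (k + Suc K)"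
      using z by (intro mult_left_mono hn zero_le_power) auto
    finally show ?thesis .
  qed
  have hs: "summable (\<lambda>k. h (k + Suc K))" 
    using sums_summable[OF h] by (rule summable_ignore_initial_segment)
  have "(\<lambda>k. f (k + Suc K)) sums ((1 + z) powr (- s) - (\<Sum>k<Suc K. f k))"
    using f by (subst sums_iff_shift) simp
  then have "(1 + z) powr (- s) - (\<Sum>k\<le>K. f k) = (\<Sum>k. f (k + Suc K))" 
    unfolding lessThan_Suc_atMost by (rule sums_unique)
  also have "norm \<dots> \<le> (\<Sum>k. (2 * norm z) ^ Suc K * h (k + Suc K))"
    using hs fl by (intro norm_suminf_le summable_mult)
  also have "\<dots> = (2 * norm z) ^ Suc K * (\<Sum>k. h (k + Suc K))" using hs by (rule suminf_mult)
  also have "(\<Sum>k. h (k + Suc K)) \<le> (\<Sum>k. h k)"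
    unfolding suminf_split_initial_segment[OF sums_summable[OF h], of "Suc K"]
    using h0 by (simp add: sum_nonneg del: sum.lessThan_Suc)
  also have "\<dots> = 2 powr B" using h by (rule sums_unique[symmetric])
  finally show ?thesis using z unfolding f_def by (simp add: mult_left_mono del: power_Suc)
qed

text \<open>With \<open>g / (s + k - 1)\<close> in the role of \<open>zeta (s + k)\<close>, the
  factor \<open>s + k - 1\<close> of the binomial coefficient cancels the pole and only the
  holomorphic \<open>g\<close> remains.\<close>

lemma gbinomial_mult_shifted_zeta:
  fixes s :: complex
  assumes "k > 0" "s + of_nat k - 1 \<noteq> 0"
  shows "((- s) gchoose k) * (g / (s + of_nat k - 1)) = - (((- s) gchoose (k - 1)) / of_nat k * g)"
proof -
  obtain j where j: "k = Suc j" using assms(1) by (cases k) auto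
  have "((- s) gchoose Suc j) = (- s gchoose j) * (- s - of_nat j) / of_nat (Suc j)"
    by (simp add: gbinomial_prod_rev atLeast0LessThan mult_ac)
  also have "\<dots> = - ((- s gchoose j) / of_nat k * (s + of_nat k - 1))"
    unfolding j by (simp add: minus_divide_left algebra_simps)
  finally show ?thesis using assms unfolding j by simp
qed

lemma holomorphic_gbinomial [holomorphic_intros]:
  "f holomorphic_on S \<Longrightarrow> (\<lambda>s. f s gchoose k) holomorphic_on S"
  unfolding gbinomial_prod_rev by (intro holomorphic_intros) auto

text \<open>
  Expanding \<open>(n + 1) powr (- s)\<close> in powers of \<open>1 / n\<close> and summing over \<open>n\<close> expresses
  \<open>s * \<zeta> (s + 1)\<close> through \<open>\<zeta> (s + 2), \<dots>, \<zeta> (s + K)\<close> and a remainder that converges for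
  \<open>Re s > - K\<close>.
\<close>

lemma zeta_half_plane_step:
  assumes hol: "g holomorphic_on {s. Re s > - real m}"
    and g: "\<And>s. Re s > 1 \<Longrightarrow> (\<lambda>n. 1 / of_nat (Suc n) powr s) sums (g s / (s - 1))"
  obtains g' where "g' holomorphic_on {s. Re s > - real (Suc m)}"
    "\<And>s. Re s > 1 \<Longrightarrow> (\<lambda>n. 1 / of_nat (Suc n) powr s) sums (g' s / (s - 1))"
proof -
  \<comment> \<open>The new function is evaluated through \<open>s = w - 1\<close>, so the target
    \<open>Re w > - (m + 1)\<close> becomes \<open>Re s > - K\<close>. There \<open>s + k\<close>
    stays in the domain of \<open>g\<close> for all \<open>k \<ge> 2\<close>.\<close>
  define K where "K = m + 2"
  define R where "R = (\<lambda>(n::nat) (s::complex). of_nat (Suc (Suc n)) powr (- s) -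
     (\<Sum>k\<le>K. ((- s) gchoose k) * of_nat (Suc n) powr (- s - of_nat k)))"
  define S where "S = {s. Re s > - real K}"
  have op: "open S" unfolding S_def by (simp add: open_halfspace_Re_gt)
  \<comment> \<open>The term \<open>R 0\<close> expands around the base 1, where
    \<open>1 / n = 1\<close> is outside the range \<open>norm z \<le> 1/2\<close> of the remainder
    bound. It is left out of the series and added back in \<open>H\<close>.\<close>
  obtain G where G: "G holomorphic_on S" "\<And>s. s \<in> S \<Longrightarrow> (\<lambda>n. R (Suc n) s) sums G s"
  proof (rule holomorphic_suminf_local_bound[OF op, of "\<lambda>n. R (Suc n)"])
    show "R (Suc n) holomorphic_on S" for n unfolding R_def
      by (intro holomorphic_intros) (auto simp: powr_def simp del: of_nat_Suc)
    fix x assume x: "x \<in> S"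
    define d where "d = (Re x + real K) / 2"
    define B where "B = norm x + d"
    have B0: "B \<ge> 0" "d > 0" unfolding B_def d_def using x by (auto simp: S_def)
    define C where "C = 2 ^ Suc K * 2 powr B"
    have "summable (\<lambda>n. real n powr (- d - 1))" using B0 by (simp add: summable_real_powr_iff)
    then have "summable (\<lambda>n. C * real (n + 2) powr (- d - 1))"
      by (intro summable_mult) (subst summable_iff_shift)
    moreover have "norm (R (Suc n) y) \<le> C * real (n + 2) powr (- d - 1)"
      if y: "y \<in> ball x d \<inter> S" for n y
    proof -
      define N where "N = n + 2"
      have N: "N \<ge> 2" "N > 0" and N_eq: "Suc (Suc n) = N" unfolding N_def by auto
      have "\<bar>Re (x - y)\<bar> \<le> norm (x - y)" by (rule abs_Re_le_cmod)
      moreover have "norm (x - y) < d" using y by (simp add: dist_norm)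
      ultimately have 1: "Re y \<ge> d - real K" unfolding d_def by (simp add: abs_if split: if_splits)
      have 2: "norm y \<le> B" unfolding B_def using \<open>norm (x - y) < d\<close>
        using norm_triangle_ineq3[of x y] by linarith
      define z where "z = (1 / of_nat N :: complex)"
      have nz: "norm z = 1 / real N" unfolding z_def by (simp add: norm_divide)
      have z: "norm z \<le> 1/2" unfolding nz using N by (simp add: field_simps)
      have e1: "of_nat (Suc N) powr (- y) = of_nat N powr (- y) * (1 + z) powr (- y)"
      proof -
        have "(of_nat (Suc N) :: complex) = of_real (real N) * of_real (1 + 1 / real N)"
          using N by (simp add: distrib_left of_real_divide)
        also have "(of_real (real N) * of_real (1 + 1 / real N)) powr (- y) =
          of_real (real N) powr (- y) * of_real (1 + 1 / real N) powr (- y)"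
          by (rule powr_times_real) auto
        finally show ?thesis by (simp add: z_def)
      qed
      have e2: "of_nat N powr (- y - of_nat k) = of_nat N powr (- y) * z ^ k" for k
        using N by (simp add: powr_diff z_def power_divide powr_nat')
      have "R (Suc n) y = of_nat N powr (- y) * ((1 + z) powr (- y) - (\<Sum>k\<le>K. ((- y) gchoose k) * z ^ k))"
        unfolding R_def N_eq e1 e2 by (simp only: right_diff_distrib sum_distrib_left mult_ac)
      also have "norm \<dots> \<le> real N powr (- Re y) * ((2 * norm z) ^ Suc K * 2 powr B)"
        unfolding norm_mult norm_of_nat_powr[OF N(2)] using binomial_remainder_bound[OF 2 z, of K]
        by (intro mult_mono) auto
      also have "\<dots> = C * (real N powr (- Re y) * (1 / real N) ^ Suc K)"
        unfolding C_def nz by (simp add: power_divide power_mult_distrib)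
      also have "real N powr (- Re y) * (1 / real N) ^ Suc K = real N powr (- Re y - real (Suc K))"
        using N by (subst powr_diff, subst powr_realpow) (auto simp: power_divide)
      also have "\<dots> \<le> real N powr (- d - 1)" using N 1 by (intro powr_mono) auto
      finally show ?thesis unfolding N_def C_def by simp
    qed
    ultimately show "\<exists>d>0. \<exists>h :: nat \<Rightarrow> real. summable h \<and> (\<forall>n. \<forall>y\<in>ball x d \<inter> S. norm (R (Suc n) y) \<le> h n)"
      using B0 by blast
  qed (rule that)
  \<comment> \<open>This is the summed expansion solved for its \<open>k = 1\<close> term: for
    \<open>Re s > 0\<close> it equals \<open>s * zeta (s + 1)\<close>, that is
    \<open>(w - 1) * zeta w\<close> at \<open>w = s + 1\<close>. The formula itself involves only
    \<open>g (s + k)\<close> with \<open>k \<ge> 2\<close>.\<close>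
  define H where "H = (\<lambda>s. 1 - (\<Sum>k=2..K. ((- s) gchoose (k - 1)) / of_nat k * g (s + of_nat k)) + (R 0 s + G s))"
  define g' where "g' = (\<lambda>w. H (w - 1))"
  have holH: "H holomorphic_on S' \<longleftrightarrow> (\<lambda>s. 1 - (\<Sum>k=2..K. ((- s) gchoose (k - 1)) / of_nat k * g (s + of_nat k)) + (R 0 s + G s)) holomorphic_on S'" for S'
    unfolding H_def ..
  have "H holomorphic_on S"
    unfolding holH
  proof (intro holomorphic_intros G(1))
    fix k assume k: "k \<in> {2..K}"
    have "(g \<circ> (\<lambda>s. s + of_nat k)) holomorphic_on S"
      by (rule holomorphic_on_compose_gen[OF _ hol]) (use k in \<open>auto intro!: holomorphic_intros simp: S_def K_def\<close>)
    then show "(\<lambda>s. g (s + of_nat k)) holomorphic_on S" by (simp add: o_def)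
    show "of_nat k \<noteq> (0::complex)" using k by simp
  next
    show "R 0 holomorphic_on S" unfolding R_def
      by (intro holomorphic_intros) (auto simp: powr_def simp del: of_nat_Suc)
  qed
  then have "(H \<circ> (\<lambda>w. w - 1)) holomorphic_on {s. Re s > - real (Suc m)}"
    by (rule holomorphic_on_compose_gen[rotated]) (auto intro!: holomorphic_intros simp: S_def K_def)
  then have hol': "g' holomorphic_on {s. Re s > - real (Suc m)}" by (simp add: g'_def o_def)
  show thesis
  proof (rule that[OF hol'])
    fix w :: complex assume w: "Re w > 1"
    define s where "s = w - 1"
    have s: "Re s > 0" "s \<noteq> 0" "s \<in> S" using w by (auto simp: s_def S_def)
    define D where "D = (\<lambda>k::nat. g (s + of_nat k) / (s + of_nat k - 1))"
    have D: "(\<lambda>n. of_nat (Suc n) powr (- s - of_nat k)) sums D k" if "k \<ge> 1" for k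
    proof -
      have "Re (s + of_nat k) > 1" using s that by simp
      from g[OF this] show ?thesis unfolding D_def
        by (simp add: powr_minus_divide[symmetric] del: of_nat_Suc)
    qed
    have "(\<lambda>n. real n powr (- Re s)) \<longlonglongrightarrow> 0"
      using s by (intro tendsto_neg_powr) (auto simp: filterlim_real_sequentially)
    then have "(\<lambda>n. norm (of_nat n powr (- s) :: complex)) \<longlonglongrightarrow> 0"
      by (rule Lim_transform_eventually)
         (auto intro!: eventually_mono[OF eventually_gt_at_top[of 0]] simp: norm_of_nat_powr)
    then have "(\<lambda>n. of_nat n powr (- s) :: complex) \<longlonglongrightarrow> 0" by (simp add: tendsto_norm_zero_iff)
    then have "(\<lambda>n. of_nat (Suc n) powr (- s) :: complex) \<longlonglongrightarrow> 0" by (rule LIMSEQ_Suc)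
    \<comment> \<open>The \<open>k = 0\<close> term is paired with the power of
      \<open>n + 2\<close>: for \<open>0 < Re s \<le> 1\<close> neither series converges alone,
      while their difference telescopes.\<close>
    from telescope_sums[OF this] have T: "(\<lambda>n. of_nat (Suc (Suc n)) powr (- s) - of_nat (Suc n) powr (- s)) sums (-1 :: complex)" by simp
    have "(\<lambda>n. R n s) sums (- 1 - (\<Sum>k=1..K. ((- s) gchoose k) * D k))"
    proof -
      have "(\<lambda>n. (of_nat (Suc (Suc n)) powr (- s) - of_nat (Suc n) powr (- s)) - (\<Sum>k=1..K. ((- s) gchoose k) * of_nat (Suc n) powr (- s - of_nat k)))
         sums (- 1 - (\<Sum>k=1..K. ((- s) gchoose k) * D k))"
        by (intro sums_diff T sums_sum sums_mult D) auto
      moreover have "{..K} = insert 0 {1..K}" by auto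
      ultimately show ?thesis unfolding R_def by (simp add: algebra_simps del: of_nat_Suc)
    qed
    moreover have "(\<lambda>n. R n s) sums (R 0 s + G s)"
      using G(2)[OF s(3)] sums_Suc_iff[of "\<lambda>n. R n s" "G s"] by (simp add: add.commute)
    ultimately have "R 0 s + G s = - 1 - (\<Sum>k=1..K. ((- s) gchoose k) * D k)" using sums_unique2 by blast
    also have "(\<Sum>k=1..K. ((- s) gchoose k) * D k) = - (s * D 1) + (\<Sum>k=2..K. ((- s) gchoose k) * D k)"
    proof -
      have "{1..K} = insert 1 {2..K}" unfolding K_def by auto
      then show ?thesis by simp
    qed
    also have "(\<Sum>k=2..K. ((- s) gchoose k) * D k) = (\<Sum>k=2..K. - (((- s) gchoose (k - 1)) / of_nat k * g (s + of_nat k)))"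
      unfolding D_def
    proof (intro sum.cong refl gbinomial_mult_shifted_zeta)
      fix k assume k: "k \<in> {2..K}"
      then have "Re (s + of_nat k - 1) > 0" using s by simp
      then show "s + of_nat k - 1 \<noteq> 0" by (metis less_irrefl zero_complex.sel(1))
    qed auto
    finally have "H s = s * D 1" unfolding H_def by (simp add: sum_negf)
    then have "g' w / (w - 1) = D 1" using s by (simp add: g'_def s_def)
    also have "D 1 = g w / (w - 1)" unfolding D_def s_def by simp
    finally show "(\<lambda>n. 1 / of_nat (Suc n) powr w) sums (g' w / (w - 1))" using g[OF w] \<open>g' w / (w - 1) = D 1\<close> by metis
  qed
qed

lemma zeta_half_plane:
  "\<exists>g. g holomorphic_on {s. Re s > - real m} \<and>
    (\<forall>s. Re s > 1 \<longrightarrow> (\<lambda>n. 1 / of_nat (Suc n) powr s) sums (g s / (s - 1)))"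
proof (induction m)
  case 0
  obtain g where "g holomorphic_on {s. Re s > 0}"
    "\<And>s. Re s > 0 \<Longrightarrow> (\<lambda>N. (s - 1) * (\<Sum>n<N. 1 / of_nat (Suc n) powr s) + of_nat N powr (1 - s)) \<longlonglongrightarrow> g s"
    using zeta_half_plane_0 by blast
  then show ?case using zeta_limit_imp_sums by (intro exI[of _ g]) auto
next
  case (Suc m)
  then obtain g where "g holomorphic_on {s. Re s > - real m}"
    "\<And>s. Re s > 1 \<Longrightarrow> (\<lambda>n. 1 / of_nat (Suc n) powr s) sums (g s / (s - 1))"
    by blast
  from zeta_half_plane_step[OF this] show ?case by metis
qed

section \<open>The entire function \<open>(s - 1) * zeta s\<close> and the meaning of
  \<open>riemann_zeta\<close>\<close>

lemma eq_on_half_plane: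
  fixes f g :: "complex \<Rightarrow> complex"
  assumes "f holomorphic_on {s. Re s > a}" "g holomorphic_on {s. Re s > a}"
    and eq: "\<And>s. Re s > b \<Longrightarrow> f s = g s" and s: "Re s > a"
  shows "f s = g s"
proof -
  define c where "c = max a b"
  have op: "open {s. Re s > c}" by (simp add: open_halfspace_Re_gt)
  have lim: "of_real (c + 1) islimpt {s. Re s > c}"
    by (rule interior_limit_point) (simp add: interior_open op)
  have "(\<lambda>s. f s - g s) holomorphic_on {s. Re s > a}" using assms(1,2) by (intro holomorphic_intros)
  then have "f s - g s = 0"
  proof (rule analytic_continuation[OF _ _ _ _ _ lim])
    show "connected {s. Re s > a}" by (intro convex_connected convex_halfspace_Re_gt)
    show "f z - g z = 0" if "z \<in> {s. Re s > c}" for z using eq[of z] that by (simp add: c_def)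
  qed (use s in \<open>auto simp: open_halfspace_Re_gt c_def\<close>)
  then show ?thesis by simp
qed

text \<open>The continuations to different half planes agree for \<open>Re s > 1\<close>, hence on
  every common half plane by the identity theorem, and therefore glue.\<close>

lemma zeta_entire:
  obtains F where "F holomorphic_on UNIV"
    "\<And>s. Re s > 1 \<Longrightarrow> (\<lambda>n. 1 / of_nat (Suc n) powr s) sums (F s / (s - 1))"
proof -
  obtain G where G: "\<And>m. G m holomorphic_on {s. Re s > - real m}"
    "\<And>m s. Re s > 1 \<Longrightarrow> (\<lambda>n. 1 / of_nat (Suc n) powr s) sums (G m s / (s - 1))"
    using zeta_half_plane by metis
  have eq1: "G m s = G k s" if "Re s > 1" for m k s
  proof -
    have "G m s / (s - 1) = G k s / (s - 1)" using G(2)[OF that] sums_unique2 by blast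
    moreover have "s \<noteq> 1" using that by auto
    ultimately show ?thesis by simp
  qed
  have eq: "G m s = G k s" if "Re s > - real m" "Re s > - real k" for m k s
    by (rule eq_on_half_plane[of _ "- real (min m k)", where b = 1])
       (use that eq1 in \<open>auto intro: holomorphic_on_subset[OF G(1)]\<close>)
  \<comment> \<open>The \<open>+ 1\<close> secures the strict inequality \<open>Re s > - m\<close>
    also when \<open>Re s\<close> is an integer \<open>\<le> 0\<close>.\<close>
  define F where "F s = G (nat \<lceil>- Re s\<rceil> + 1) s" for s
  have F: "F s = G m s" if "Re s > - real m" for m s
    unfolding F_def by (rule eq) (use that in linarith)+
  show thesis
  proof (rule that[of F])
    have "F holomorphic_on {s. Re s > - real m}" for m
      by (rule holomorphic_transform[OF G(1)]) (simp add: F)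
    then have "F holomorphic_on (\<Union>m. {s. Re s > - real m})"
      by (intro holomorphic_on_UN_open) (auto simp: open_halfspace_Re_gt)
    moreover have "(\<Union>m. {s. Re s > - real m}) = UNIV"
    proof (intro set_eqI iffI UNIV_I)
      fix s :: complex
      obtain m where "- Re s < real m" using reals_Archimedean2 by blast
      then show "s \<in> (\<Union>m. {s. Re s > - real m})" by (auto intro: exI[of _ m])
    qed
    ultimately show "F holomorphic_on UNIV" by simp
    show "(\<lambda>n. 1 / of_nat (Suc n) powr s) sums (F s / (s - 1))" if "Re s > 1" for s
      using G(2)[OF that, of 0] F[of 0 s] that by simp
  qed
qed

text \<open>This resolves the definite description. Existence comes from dividing the entire
  function by \<open>s - 1\<close>, uniqueness from the identity theorem on the connected punctured
  plane together with the prescribed value at 1.\<close>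

lemma riemann_zeta_props:
  shows riemann_zeta_entire: "\<exists>F. F holomorphic_on UNIV \<and> (\<forall>s. s \<noteq> 1 \<longrightarrow> riemann_zeta s = F s / (s - 1))"
    and riemann_zeta_sums: "Re s > 1 \<Longrightarrow> (\<lambda>n. 1 / of_nat (Suc n) powr s) sums riemann_zeta s"
proof -
  obtain F where F: "F holomorphic_on UNIV"
    "\<And>s. Re s > 1 \<Longrightarrow> (\<lambda>n. 1 / of_nat (Suc n) powr s) sums (F s / (s - 1))"
    using zeta_entire by blast
  define Z where "Z = (\<lambda>s. if s = 1 then 0 else F s / (s - 1))"
  define P where "P = (\<lambda>f. f holomorphic_on - {1} \<and>
     (\<forall>s. Re s > 1 \<longrightarrow> (\<lambda>n. 1 / of_nat (Suc n) powr s) sums f s) \<and> f 1 = (0::complex))"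
  have "(\<lambda>s. F s / (s - 1)) holomorphic_on - {1}"
    by (intro holomorphic_intros holomorphic_on_subset[OF F(1)]) auto
  then have "Z holomorphic_on - {1}"
    by (rule holomorphic_transform) (auto simp: Z_def)
  moreover have "(\<lambda>n. 1 / of_nat (Suc n) powr s) sums Z s" if "Re s > 1" for s
    using F(2)[OF that] that by (auto simp: Z_def)
  ultimately have PZ: "P Z" unfolding P_def by (auto simp: Z_def)
  have "f = Z" if f: "P f" for f
  proof
    fix w
    show "f w = Z w"
    proof (cases "w = 1")
      case False
      have op: "open {s. Re s > 1}" by (simp add: open_halfspace_Re_gt)
      have lim: "2 islimpt {s. Re s > 1}"
        by (rule interior_limit_point) (simp add: interior_open op)
      have "(\<lambda>s. f s - Z s) holomorphic_on - {1}" using f PZ unfolding P_def by (intro holomorphic_intros) auto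
      then have "f w - Z w = 0"
      proof (rule analytic_continuation[OF _ _ _ _ _ lim])
        show "f z - Z z = 0" if "z \<in> {s. Re s > 1}" for z
          using f PZ that sums_unique2 unfolding P_def by fastforce
        show "connected (- {1::complex})" by (intro connected_punctured_universe) simp
      qed (use False in auto)
      then show ?thesis by simp
    qed (use f PZ in \<open>auto simp: P_def\<close>)
  qed
  with PZ have Z: "riemann_zeta = Z" unfolding riemann_zeta_def P_def[symmetric] by (rule the_equality[where P = P])
  show "\<exists>F. F holomorphic_on UNIV \<and> (\<forall>s. s \<noteq> 1 \<longrightarrow> riemann_zeta s = F s / (s - 1))"
    unfolding Z Z_def by (intro exI[of _ F] conjI F(1)) simp
  show "(\<lambda>n. 1 / of_nat (Suc n) powr s) sums riemann_zeta s" if "Re s > 1"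
    using PZ that unfolding Z P_def by blast
qed

text \<open>Both \<open>g\<close> and \<open>F\<close> are \<open>(s - 1) * zeta s\<close> for
  \<open>Re s > 1\<close>, so they coincide on \<open>Re s > 0\<close>. This carries the limit
  formula to the critical line.\<close>

lemma riemann_zeta_LIMSEQ:
  assumes s: "Re s > 0" "s \<noteq> 1"
  shows "(\<lambda>N. (\<Sum>n<N. 1 / of_nat (Suc n) powr s) - of_nat N powr (1 - s) / (1 - s)) \<longlonglongrightarrow> riemann_zeta s"
proof -
  obtain F where F: "F holomorphic_on UNIV" "\<And>s. s \<noteq> 1 \<Longrightarrow> riemann_zeta s = F s / (s - 1)"
    using riemann_zeta_entire by blast
  obtain g where g: "g holomorphic_on {s. Re s > 0}"
    "\<And>s. Re s > 0 \<Longrightarrow> (\<lambda>N. (s - 1) * (\<Sum>n<N. 1 / of_nat (Suc n) powr s) + of_nat N powr (1 - s)) \<longlonglongrightarrow> g s"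
    using zeta_half_plane_0 by blast
  have "g s = F s"
  proof (rule eq_on_half_plane[OF g(1), of F 1])
    fix z :: complex assume z: "Re z > 1"
    then have "z \<noteq> 1" by auto
    have "(\<lambda>n. 1 / of_nat (Suc n) powr z) sums (g z / (z - 1))"
      using z g(2)[of z] by (intro zeta_limit_imp_sums) auto
    then have "g z / (z - 1) = riemann_zeta z" using riemann_zeta_sums[OF z] sums_unique2 by blast
    then show "g z = F z" using F(2)[OF \<open>z \<noteq> 1\<close>] \<open>z \<noteq> 1\<close> by simp
  qed (use s F(1) in \<open>auto intro: holomorphic_on_subset\<close>)
  then have "riemann_zeta s = g s / (s - 1)" using F(2)[OF s(2)] by simp
  moreover have "(\<lambda>N. ((s - 1) * (\<Sum>n<N. 1 / of_nat (Suc n) powr s) + of_nat N powr (1 - s)) / (s - 1)) \<longlonglongrightarrow> g s / (s - 1)"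
    using s by (intro tendsto_intros g(2)) auto
  moreover have "((s - 1) * A + B) / (s - 1) = A - B / (1 - s)" for A B
    using s(2) by (simp add: divide_simps) (simp add: algebra_simps)
  ultimately show ?thesis by simp
qed

subsection \<open>The Fourier transform of 1 / cosh\<close>

lemma integrable_exp_half_line:
  assumes "a > (0::real)"
  shows "integrable lborel (\<lambda>x. indicator {0..} x *\<^sub>R exp (- a * x))"
proof -
  have "(\<lambda>x. exp (- a * x)) integrable_on {0..}" using integrable_on_exp_minus_to_infinity[OF assms] .
  then have "(\<lambda>x. exp (- a * x)) absolutely_integrable_on {0..}"
    by (intro nonnegative_absolutely_integrable_1) auto
  then show ?thesis unfolding set_integrable_def
    by (subst (asm) integrable_completion) auto
qed

lemma integrable_exp_half_line_complex:
  fixes a :: complex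
  assumes "Re a > 0"
  shows "integrable lborel (\<lambda>x. indicator {0..} x *\<^sub>R exp (- a * of_real x))"
  by (rule Bochner_Integration.integrable_bound[OF integrable_exp_half_line[OF assms]])
     (auto simp: indicator_def)

text \<open>The fundamental theorem applies on \<open>{0..n}\<close>, and dominated convergence with
  the norm of the full integrand as majorant lets \<open>n\<close> grow.\<close>

lemma integral_half_line_FTC:
  fixes f F :: "real \<Rightarrow> 'a :: euclidean_space"
  assumes int: "integrable lborel (\<lambda>x. indicator {0..} x *\<^sub>R f x)"
    and cont: "continuous_on {0..} f"
    and deriv: "\<And>x. x \<ge> 0 \<Longrightarrow> (F has_vector_derivative f x) (at x)"
    and lim: "(\<lambda>n. F (real n)) \<longlonglongrightarrow> L"
  shows "(LINT x|lborel. indicator {0..} x *\<^sub>R f x) = L - F 0"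
proof (rule LIMSEQ_unique)
  show "(\<lambda>n. LINT x|lborel. indicator {0..real n} x *\<^sub>R f x)
     \<longlonglongrightarrow> (LINT x|lborel. indicator {0..} x *\<^sub>R f x)"
  proof (rule integral_dominated_convergence)
    show "integrable lborel (\<lambda>x. norm (indicator {0..} x *\<^sub>R f x))" using int by (rule integrable_norm)
    show "AE x in lborel. (\<lambda>n. indicator {0..real n} x *\<^sub>R f x) \<longlonglongrightarrow> indicator {0..} x *\<^sub>R f x"
    proof (intro AE_I2 tendsto_eventually)
      fix x :: real
      obtain m where "x \<le> real m" using real_arch_simple by blast
      then show "\<forall>\<^sub>F n in sequentially. indicator {0..real n} x *\<^sub>R f x = indicator {0..} x *\<^sub>R f x"
        by (intro eventually_mono[OF eventually_ge_at_top[of m]]) (auto simp: indicator_def)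
    qed
    have "set_integrable lborel {0..real n} f" for n
      using cont by (intro borel_integrable_atLeastAtMost') (auto intro: continuous_on_subset)
    then show "(\<lambda>x. indicator {0..real n} x *\<^sub>R f x) \<in> borel_measurable lborel" for n
      unfolding set_integrable_def by (rule borel_measurable_integrable)
  qed (use int in \<open>auto simp: indicator_def\<close>)
  have "(LINT x|lborel. indicator {0..real n} x *\<^sub>R f x) = F (real n) - F 0" for n
  proof -
    have i: "set_integrable lborel {0..real n} f"
      using cont by (intro borel_integrable_atLeastAtMost') (auto intro: continuous_on_subset)
    have "(f has_integral (F (real n) - F 0)) {0..real n}"
      by (intro fundamental_theorem_of_calculus)
         (auto intro: has_vector_derivative_at_within deriv)
    then show ?thesis using set_borel_integral_eq_integral(2)[OF i]
      by (simp add: set_lebesgue_integral_def integral_unique)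
  qed
  then show "(\<lambda>n. LINT x|lborel. indicator {0..real n} x *\<^sub>R f x) \<longlonglongrightarrow> L - F 0"
    using lim by (simp add: tendsto_diff)
qed

lemma integral_exp_half_line:
  fixes a :: complex
  assumes a: "Re a > 0"
  shows "(LINT x|lborel. indicator {0..} x *\<^sub>R exp (- a * of_real x)) = 1 / a"
proof -
  have a0: "a \<noteq> 0" using a by auto
  have "(\<lambda>n. exp (- Re a * real n)) \<longlonglongrightarrow> 0" using a by real_asymp
  then have "(\<lambda>n. norm (exp (- a * of_real (real n)))) \<longlonglongrightarrow> 0" by simp
  then have lim: "(\<lambda>n. exp (- a * of_real (real n))) \<longlonglongrightarrow> 0" by (simp only: tendsto_norm_zero_iff)
  have "(LINT x|lborel. indicator {0..} x *\<^sub>R exp (- a * of_real x)) = - 0 / a - - exp (- a * of_real 0) / a"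
  proof (rule integral_half_line_FTC[OF integrable_exp_half_line_complex[OF a]])
    show "((\<lambda>x. - exp (- a * of_real x) / a) has_vector_derivative exp (- a * of_real x)) (at x)" for x
      using a0 by (auto intro!: derivative_eq_intros has_vector_derivative_real_field simp: field_simps)
    show "(\<lambda>n. - exp (- a * of_real (real n)) / a) \<longlonglongrightarrow> - 0 / a"
      by (intro tendsto_intros lim a0)
  qed (auto intro!: continuous_intros)
  then show ?thesis by simp
qed

lemma inverse_cosh_le_exp: "1 / cosh x \<le> 2 * exp (- \<bar>x\<bar>)" for x :: real
proof -
  have "exp \<bar>x\<bar> \<le> 2 * cosh x" unfolding cosh_field_def by (cases "x \<ge> 0") auto
  then show ?thesis using cosh_real_pos[of x] by (simp add: exp_minus field_simps)
qed

lemma integrable_inverse_cosh: "integrable lborel (\<lambda>x::real. 1 / cosh (pi * x))"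
proof -
  have 1: "integrable lborel (\<lambda>x. indicator {0..} x *\<^sub>R exp (- pi * x))"
    by (rule integrable_exp_half_line) simp
  have 2: "integrable lborel (\<lambda>x. indicator {0..} (- x) *\<^sub>R exp (- pi * (- x)))"
    using lborel_integrable_real_affine[OF 1, of "-1" 0] by simp
  show ?thesis
  proof (rule Bochner_Integration.integrable_bound)
    show "integrable lborel (\<lambda>x. 2 * (indicator {0..} x *\<^sub>R exp (- pi * x) + indicator {0..} (- x) *\<^sub>R exp (- pi * (- x))))"
      using 1 2 by (intro integrable_mult_right Bochner_Integration.integrable_add)
    show "AE x in lborel. norm (1 / cosh (pi * x)) \<le> norm (2 * (indicator {0..} x *\<^sub>R exp (- pi * x) + indicator {0..} (- x) *\<^sub>R exp (- pi * (- x))))"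
    proof (intro AE_I2)
      fix x :: real
      show "norm (1 / cosh (pi * x)) \<le> norm (2 * (indicator {0..} x *\<^sub>R exp (- pi * x) + indicator {0..} (- x) *\<^sub>R exp (- pi * (- x))))"
        using inverse_cosh_le_exp[of "pi * x"] cosh_real_pos[of "pi * x"]
        by (cases x "0::real" rule: linorder_cases) (auto simp: abs_mult)
    qed
  qed (simp add: borel_measurable_continuous_onI continuous_intros)
qed

section \<open>Zeros of \<open>cosh\<close> and the contour integral\<close>

text \<open>Reverse triangle inequality for \<open>exp z\<close> and \<open>exp (- z)\<close>. It
  serves twice: to force the zeros of \<open>cosh\<close> onto the imaginary axis and to bound the
  integrand on the vertical sides of the rectangle.\<close>

lemma abs_sinh_Re_le_norm_cosh: "\<bar>sinh (Re z)\<bar> \<le> norm (cosh z)"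
proof -
  have "\<bar>norm (exp z) - norm (exp (- z))\<bar> \<le> norm (exp z + exp (- z))"
    using norm_triangle_ineq3[of "exp z" "- exp (- z)"] by simp
  then show ?thesis by (simp add: cosh_field_def sinh_field_def norm_divide)
qed

text \<open>A zero has real part 0, and on the imaginary axis \<open>cosh\<close> turns into
  \<open>cos\<close>, so \<open>Im z\<close> is half an odd integer; strictly between
  \<open>- 1/2\<close> and \<open>3/2\<close> this leaves \<open>1/2\<close>.\<close>

lemma cosh_pi_zero_strip:
  fixes z :: complex
  assumes "cosh (pi * z) = (0::complex)" "- 1/2 < Im z" "Im z < 3/2"
  shows "z = \<i> / 2"
proof -
  have "sinh (Re (pi * z)) = 0" using abs_sinh_Re_le_norm_cosh[of "pi * z"] assms by simp
  then have re: "Re z = 0" by simp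
  then have z: "z = \<i> * of_real (Im z)" by (simp add: complex_eq_iff)
  have "cosh (pi * z) = of_real (cos (pi * Im z))"
    by (subst z) (simp add: cosh_conv_cos mult_ac flip: cos_of_real)
  then have "cos (pi * Im z) = 0" using assms by simp
  then obtain i where i: "odd i" "pi * Im z = of_int i * (pi / 2)" using cos_zero_iff_int by blast
  then have "Im z = of_int i / 2" by (simp add: field_simps)
  then have "- 1 < i" "i < 3" using assms by auto
  then have "i = 1" using i(1) by presburger
  then show ?thesis using re \<open>Im z = of_int i / 2\<close> by (simp add: complex_eq_iff)
qed

lemma cosh_pi_add_ii: "cosh (pi * (z + \<i>)) = - cosh (pi * z)" for z :: complex
proof -
  have "exp (pi * (z + \<i>)) = - exp (pi * z)"
    by (simp add: distrib_left exp_add)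
  moreover have "exp (- (pi * (z + \<i>))) = - exp (- (pi * z))"
    using calculation by (simp only: exp_minus inverse_minus_eq)
  ultimately show ?thesis by (simp add: cosh_field_def minus_divide_left)
qed

lemma holomorphic_cosh [holomorphic_intros]:
  "f holomorphic_on S \<Longrightarrow> (\<lambda>z. cosh (f z)) holomorphic_on S"
  unfolding cosh_field_def by (intro holomorphic_intros) auto

lemma cosh_of_real: "cosh (of_real x) = complex_of_real (cosh x)"
  by (simp add: cosh_field_def exp_of_real flip: of_real_minus)

text \<open>
  The rectangle with horizontal sides on \<open>Im z = 0\<close> and \<open>Im z = 1\<close> encloses only the pole at
  \<open>\<i> / 2\<close>, and the integrand on the upper side is a constant multiple of that on the lower side.
\<close>

lemma sech_rectangle:
  fixes \<xi> R :: real and f :: "complex \<Rightarrow> complex"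
  assumes R: "R > 0"
  defines "f \<equiv> \<lambda>z::complex. exp (\<i> * \<xi> * z) / cosh (pi * z)"
  shows "norm ((1 + exp (- \<xi>)) * integral {-R..R} (\<lambda>x. f (complex_of_real x)) - 2 * exp (- \<xi> / 2)) \<le> 2 * exp \<bar>\<xi>\<bar> / sinh (pi * R)"
proof -
  \<comment> \<open>The strip reaches up to the neighbouring zeros \<open>- \<i> / 2\<close> and
    \<open>3 * \<i> / 2\<close> of the denominator.\<close>
  define S where "S = {z. - 1/2 < Im z} \<inter> {z. Im z < 3/2}"
  have opS: "open S" unfolding S_def by (intro open_Int open_halfspace_Im_gt open_halfspace_Im_lt)
  have coS: "connected S" unfolding S_def
    by (intro convex_connected convex_Int convex_halfspace_Im_gt convex_halfspace_Im_lt)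
  have holf: "f holomorphic_on (S - {\<i>/2})" unfolding f_def
    using cosh_pi_zero_strip by (intro holomorphic_intros) (fastforce simp: S_def)+
  define a2 where "a2 = Complex R 0"
  define a3 where "a3 = Complex R 1"
  define a4 where "a4 = Complex (-R) 1"
  define a1 where "a1 = Complex (-R) 0"
  \<comment> \<open>At the simple pole the residue is the numerator over the derivative
    \<open>pi * sinh (pi * \<i> / 2) = pi * \<i>\<close> of the denominator.\<close>
  have res: "residue f (\<i>/2) = exp (- \<xi> / 2) / (pi * \<i>)"
  proof -
    have "residue f (\<i>/2) = exp (\<i> * \<xi> * (\<i>/2)) / (pi * \<i>)"
      unfolding f_def
    proof (rule residue_simple_pole_deriv[where s = S])
      show "((\<lambda>z. cosh (pi * z)) has_field_derivative pi * \<i>) (at (\<i>/2))"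
        by (auto intro!: derivative_eq_intros simp: sinh_conv_sin sin_of_real[symmetric] mult_ac simp del: sin_of_real)
      show "cosh (pi * (\<i>/2)) = (0::complex)"
        by (simp add: cosh_conv_cos cos_of_real[symmetric] mult_ac del: cos_of_real)
    qed (use opS coS in \<open>auto intro!: holomorphic_intros simp: S_def\<close>)
    then show ?thesis by (simp add: exp_of_real[symmetric] mult_ac del: exp_of_real)
  qed
  have "contour_integral (rectpath a1 a3) f = 2 * pi * \<i> * (\<Sum>p\<in>{\<i>/2}. winding_number (rectpath a1 a3) p * residue f p)"
  proof (rule Residue_theorem[OF opS coS])
    show "path_image (rectpath a1 a3) \<subseteq> S - {\<i>/2}"
      using R by (auto simp: path_image_rectpath a1_def a3_def S_def)
    show "\<forall>z. z \<notin> S \<longrightarrow> winding_number (rectpath a1 a3) z = 0"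
    proof (intro allI impI)
      fix z assume "z \<notin> S"
      then have "z \<notin> cbox a1 a3" by (auto simp: in_cbox_complex_iff a1_def a3_def S_def)
      then show "winding_number (rectpath a1 a3) z = 0"
        by (intro winding_number_rectpath_outside) (use R in \<open>auto simp: a1_def a3_def\<close>)
    qed
  qed (use holf in auto)
  moreover have "winding_number (rectpath a1 a3) (\<i>/2) = 1"
    by (rule winding_number_rectpath) (use R in \<open>auto simp: in_box_complex_iff a1_def a3_def\<close>)
  ultimately have CI: "contour_integral (rectpath a1 a3) f = 2 * exp (- \<xi> / 2)" by (simp add: res field_simps)
  have cont: "continuous_on (closed_segment a b) f" if "closed_segment a b \<subseteq> S - {\<i>/2}" for a b
    using holf that holomorphic_on_imp_continuous_on continuous_on_subset by blast
  have seg: "closed_segment a1 a2 \<subseteq> S - {\<i>/2}" "closed_segment a2 a3 \<subseteq> S - {\<i>/2}"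
     "closed_segment a3 a4 \<subseteq> S - {\<i>/2}" "closed_segment a4 a1 \<subseteq> S - {\<i>/2}"
    using R by (auto simp: a1_def a2_def a3_def a4_def S_def closed_segment_same_Re closed_segment_same_Im closed_segment_eq_real_ivl)
  note int = contour_integrable_continuous_linepath[OF cont[OF seg(1)]] contour_integrable_continuous_linepath[OF cont[OF seg(2)]]
     contour_integrable_continuous_linepath[OF cont[OF seg(3)]] contour_integrable_continuous_linepath[OF cont[OF seg(4)]]
  have split: "contour_integral (rectpath a1 a3) f = contour_integral (linepath a1 a2) f + contour_integral (linepath a2 a3) f
     + contour_integral (linepath a3 a4) f + contour_integral (linepath a4 a1) f"
  proof -
    have "Complex (Re a3) (Im a1) = a2" "Complex (Re a1) (Im a3) = a4"
      by (auto simp: a1_def a2_def a3_def a4_def)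
    then show ?thesis unfolding rectpath_def Let_def
      using int by (simp add: contour_integrable_joinI add.assoc)
  qed
  define J where "J = integral {-R..R} (\<lambda>x. f (of_real x))"
  have bottom: "contour_integral (linepath a1 a2) f = J"
    unfolding J_def using R by (subst contour_integral_linepath_Reals_eq) (auto simp: a1_def a2_def complex_is_Real_iff)
  \<comment> \<open>Two signs cancel: the upper side is traversed backwards, and the shift by
    \<open>\<i>\<close> multiplies \<open>f\<close> by \<open>- exp (- \<xi>)\<close>.\<close>
  have top: "contour_integral (linepath a3 a4) f = exp (- \<xi>) * J"
  proof -
    have "contour_integral (linepath a3 a4) f = - contour_integral (linepath a4 a3) f"
      using int(3) by (metis contour_integral_reversepath reversepath_linepath valid_path_linepath)
    also have "contour_integral (linepath a4 a3) f = contour_integral (linepath a1 a2) (\<lambda>z. f (z + \<i>))"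
    proof -
      have e: "linepath a4 a3 = (\<lambda>t. linepath a1 a2 t + \<i>)"
        by (auto simp: linepath_def a1_def a2_def a3_def a4_def fun_eq_iff complex_eq_iff algebra_simps)
      have d: "a3 - a4 = a2 - a1" by (auto simp: a1_def a2_def a3_def a4_def complex_eq_iff)
      show ?thesis unfolding contour_integral_integral vector_derivative_linepath_at d e[symmetric]
        by (simp add: vector_derivative_linepath_at d e)
    qed
    also have "(\<lambda>z. f (z + \<i>)) = (\<lambda>z. - exp (- \<xi>) * f z)"
    proof
      fix z
      have "exp (\<i> * \<xi> * (z + \<i>)) = of_real (exp (- \<xi>)) * exp (\<i> * \<xi> * z)"
        by (simp add: distrib_left exp_add flip: exp_of_real) (simp add: mult_ac)
      then show "f (z + \<i>) = - exp (- \<xi>) * f z" unfolding f_def cosh_pi_add_ii by simp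
    qed
    also have "contour_integral (linepath a1 a2) (\<lambda>z. - exp (- \<xi>) * f z) = - exp (- \<xi>) * J"
      using contour_integral_lmul[OF int(1), of "- exp (- \<xi>)"] unfolding bottom .
    finally show ?thesis by simp
  qed
  have sR: "sinh (pi * R) > 0" using R by simp
  have fb: "norm (f z) \<le> exp \<bar>\<xi>\<bar> / sinh (pi * R)" if "\<bar>Re z\<bar> = R" "0 \<le> Im z" "Im z \<le> 1" for z
  proof -
    have "norm (exp (\<i> * \<xi> * z)) = exp (- \<xi> * Im z)" by simp
    also have "- \<xi> * Im z \<le> \<bar>\<xi>\<bar>"
    proof -
      have "- \<xi> * Im z \<le> \<bar>\<xi> * Im z\<bar>" by linarith
      also have "\<dots> \<le> \<bar>\<xi>\<bar>" using that by (simp add: abs_mult mult_left_le)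
      finally show ?thesis .
    qed
    finally have 1: "norm (exp (\<i> * \<xi> * z)) \<le> exp \<bar>\<xi>\<bar>" by simp
    have "\<bar>sinh (pi * Re z)\<bar> = sinh (pi * R)"
      using that(1) R by (cases "Re z \<ge> 0") (auto simp: abs_of_nonpos mult_nonneg_nonpos)
    then have "sinh (pi * R) \<le> norm (cosh (pi * z))" using abs_sinh_Re_le_norm_cosh[of "pi * z"] by simp
    then show ?thesis unfolding f_def norm_divide using 1 sR by (intro frac_le) auto
  qed
  have s1: "norm (contour_integral (linepath a2 a3) f) \<le> exp \<bar>\<xi>\<bar> / sinh (pi * R) * norm (a3 - a2)"
  proof (rule contour_integral_bound_linepath[OF int(2)])
    fix z assume "z \<in> closed_segment a2 a3"
    then have "\<bar>Re z\<bar> = R" "0 \<le> Im z" "Im z \<le> 1"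
      using R by (auto simp: a1_def a2_def a3_def a4_def closed_segment_same_Re closed_segment_eq_real_ivl)
    then show "norm (f z) \<le> exp \<bar>\<xi>\<bar> / sinh (pi * R)" by (rule fb)
  qed (use sR in simp)
  have s2: "norm (contour_integral (linepath a4 a1) f) \<le> exp \<bar>\<xi>\<bar> / sinh (pi * R) * norm (a1 - a4)"
  proof (rule contour_integral_bound_linepath[OF int(4)])
    fix z assume "z \<in> closed_segment a4 a1"
    then have "\<bar>Re z\<bar> = R" "0 \<le> Im z" "Im z \<le> 1"
      using R by (auto simp: a1_def a2_def a3_def a4_def closed_segment_same_Re closed_segment_eq_real_ivl)
    then show "norm (f z) \<le> exp \<bar>\<xi>\<bar> / sinh (pi * R)" by (rule fb)
  qed (use sR in simp)
  have "a3 - a2 = \<i>" "a1 - a4 = - \<i>" by (auto simp: a1_def a2_def a3_def a4_def complex_eq_iff)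
  with s1 s2 have s: "norm (contour_integral (linepath a2 a3) f) \<le> exp \<bar>\<xi>\<bar> / sinh (pi * R)"
    "norm (contour_integral (linepath a4 a1) f) \<le> exp \<bar>\<xi>\<bar> / sinh (pi * R)" by simp_all
  have "(1 + exp (- \<xi>)) * J - 2 * exp (- \<xi> / 2) = - (contour_integral (linepath a2 a3) f + contour_integral (linepath a4 a1) f)"
    unfolding CI[symmetric] split bottom top by (simp add: algebra_simps)
  also have "norm \<dots> \<le> 2 * exp \<bar>\<xi>\<bar> / sinh (pi * R)"
    unfolding norm_minus_cancel using s by (intro order.trans[OF norm_triangle_ineq]) simp
  finally show ?thesis unfolding J_def by simp
qed

text \<open>The vertical sides vanish as the rectangle grows. The factor left on the integral is
  \<open>1 + exp (- \<xi>) = 2 * exp (- \<xi> / 2) * cosh (\<xi> / 2)\<close>, whose exponential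
  part cancels against the residue.\<close>

lemma sech_fourier:
  fixes \<xi> :: real
  shows "(LINT x|lborel. exp (\<i> * \<xi> * of_real x) / of_real (cosh (pi * x))) = of_real (1 / cosh (\<xi> / 2))"
proof -
  define f where "f = (\<lambda>x. exp (\<i> * \<xi> * of_real x) / of_real (cosh (pi * x)))"
  have cf: "continuous_on UNIV f" unfolding f_def by (intro continuous_intros) auto
  have mf: "f \<in> borel_measurable lborel" using cf by (simp add: borel_measurable_continuous_onI)
  have nf: "norm (f x) = 1 / cosh (pi * x)" for x unfolding f_def by (simp add: norm_divide)
  have lim1: "(\<lambda>n. LINT x|lborel. indicator {-real n..real n} x *\<^sub>R f x) \<longlonglongrightarrow> (LINT x|lborel. f x)"
  proof (rule integral_dominated_convergence[OF mf _ integrable_inverse_cosh])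
    show "AE x in lborel. (\<lambda>n. indicator {-real n..real n} x *\<^sub>R f x) \<longlonglongrightarrow> f x"
    proof (intro AE_I2 tendsto_eventually)
      fix x :: real
      obtain m where "\<bar>x\<bar> \<le> real m" using real_arch_simple by blast
      then show "\<forall>\<^sub>F n in sequentially. indicator {-real n..real n} x *\<^sub>R f x = f x"
        by (intro eventually_mono[OF eventually_ge_at_top[of m]]) (auto simp: indicator_def)
    qed
  qed (use mf in \<open>auto simp: indicator_def nf\<close>)
  have eqn: "(LINT x|lborel. indicator {-real n..real n} x *\<^sub>R f x) = integral {-real n..real n} f" for n
  proof -
    have i: "set_integrable lborel {-real n..real n} f"
      using cf by (intro borel_integrable_atLeastAtMost') (auto intro: continuous_on_subset)
    show ?thesis using set_borel_integral_eq_integral(2)[OF i] by (simp add: set_lebesgue_integral_def)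
  qed
  have "(\<lambda>n. 2 * exp \<bar>\<xi>\<bar> / sinh (pi * real n)) \<longlonglongrightarrow> 0" by real_asymp
  then have "(\<lambda>n. of_real (1 + exp (- \<xi>)) * integral {-real n..real n} f - of_real (2 * exp (- \<xi> / 2))) \<longlonglongrightarrow> 0"
  proof (rule Lim_null_comparison[rotated])
    show "\<forall>\<^sub>F n in sequentially. norm (of_real (1 + exp (- \<xi>)) * integral {-real n..real n} f - of_real (2 * exp (- \<xi> / 2))) \<le> 2 * exp \<bar>\<xi>\<bar> / sinh (pi * real n)"
    proof (rule eventually_mono[OF eventually_gt_at_top[of 0]])
      fix n :: nat assume "n > 0"
      then have "real n > 0" by simp
      have "cosh (complex_of_real pi * of_real x) = of_real (cosh (pi * x))" for x
        using cosh_of_real[of "pi * x"] by simp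
      then show "norm (of_real (1 + exp (- \<xi>)) * integral {-real n..real n} f - of_real (2 * exp (- \<xi> / 2))) \<le> 2 * exp \<bar>\<xi>\<bar> / sinh (pi * real n)"
        using sech_rectangle[OF \<open>real n > 0\<close>, of \<xi>] unfolding f_def by simp
    qed
  qed
  moreover have "(\<lambda>n. of_real (1 + exp (- \<xi>)) * integral {-real n..real n} f - of_real (2 * exp (- \<xi> / 2)))
     \<longlonglongrightarrow> of_real (1 + exp (- \<xi>)) * (LINT x|lborel. f x) - of_real (2 * exp (- \<xi> / 2))"
    using lim1 unfolding eqn by (intro tendsto_intros)
  ultimately have "of_real (1 + exp (- \<xi>)) * (LINT x|lborel. f x) = of_real (2 * exp (- \<xi> / 2))"
    using LIMSEQ_unique by fastforce
  moreover have "2 * exp (- \<xi> / 2) = (1 + exp (- \<xi>)) * (1 / cosh (\<xi> / 2))"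
  proof -
    have "exp (- \<xi> / 2) * exp (\<xi> / 2) = 1" "exp (- \<xi> / 2) * exp (- \<xi> / 2) = exp (- \<xi>)"
      by (simp_all flip: exp_add)
    then have "1 + exp (- \<xi>) = 2 * exp (- \<xi> / 2) * cosh (\<xi> / 2)"
      by (simp add: cosh_field_def field_simps)
    then show ?thesis by simp
  qed
  ultimately have "of_real (1 + exp (- \<xi>)) * (LINT x|lborel. f x) = of_real (1 + exp (- \<xi>)) * of_real (1 / cosh (\<xi> / 2))"
    by (simp only: of_real_mult)
  moreover have "of_real (1 + exp (- \<xi>)) \<noteq> (0::complex)"
    using exp_gt_zero[of "- \<xi>"] unfolding of_real_eq_0_iff by linarith
  ultimately show "(LINT x|lborel. exp (\<i> * \<xi> * of_real x) / of_real (cosh (pi * x))) = of_real (1 / cosh (\<xi> / 2))"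
    unfolding f_def by (rule mult_left_cancel[THEN iffD1, rotated])
qed

subsection \<open>Mellin integrals on the critical line\<close>

text \<open>
  The substitution \<open>x = exp (- v)\<close> turns this into the integral of \<open>x powr \<omega> / (x + y)\<close> over
  \<open>0 < x < 1\<close>.
\<close>

definition stieltjes :: "real \<Rightarrow> complex \<Rightarrow> complex" where
  "stieltjes y \<omega> = (LINT v|lborel. indicator {0..} v *\<^sub>R (exp (- \<omega> * of_real v) / of_real (1 + y * exp v)))"

text \<open>With \<open>\<xi> = - \<sigma> * ln y\<close> the integrand is
  \<open>y powr (- 1/2)\<close> times that of the Fourier transform. The transform is even in
  \<open>\<xi>\<close>, so the sign \<open>\<sigma>\<close> disappears, and
  \<open>y powr (- 1/2) / cosh (ln y / 2) = 2 / (1 + y)\<close>.\<close>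

lemma sech_mellin:
  fixes y \<sigma> :: real
  assumes y: "y > 0" and \<sigma>: "\<sigma> \<in> {1, -1}"
  shows "(LINT u|lborel. of_real y powr (- (1/2 + of_real \<sigma> * \<i> * of_real u)) / of_real (cosh (pi * u))) = of_real (2 / (1 + y))"
proof -
  define \<xi> where "\<xi> = - \<sigma> * ln y"
  have "of_real y powr (- (1/2 + of_real \<sigma> * \<i> * of_real u)) = of_real (exp (- ln y / 2)) * exp (\<i> * \<xi> * of_real u)" for u
    using y by (simp add: powr_def Ln_of_real \<xi>_def exp_of_real[symmetric] exp_add[symmetric] del: exp_of_real)
       (simp add: algebra_simps)
  then have "(LINT u|lborel. of_real y powr (- (1/2 + of_real \<sigma> * \<i> * of_real u)) / of_real (cosh (pi * u)))
     = of_real (exp (- ln y / 2)) * (LINT u|lborel. exp (\<i> * \<xi> * of_real u) / of_real (cosh (pi * u)))"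
    by (simp flip: integral_mult_right_zero)
  also have "\<dots> = of_real (exp (- ln y / 2) * (1 / cosh (\<xi> / 2)))"
    unfolding sech_fourier by simp
  also have "cosh (\<xi> / 2) = cosh (ln y / 2)" using \<sigma> by (auto simp: \<xi>_def)
  also have "exp (- ln y / 2) * (1 / cosh (ln y / 2)) = 2 / (1 + y)"
  proof -
    define e where "e = exp (ln y / 2)"
    have e: "e > 0" "e * e = y" unfolding e_def using y by (simp_all flip: exp_add)
    have c: "cosh (ln y / 2) = (e + 1 / e) / 2" "exp (- ln y / 2) = 1 / e"
      unfolding e_def by (simp_all add: cosh_field_def exp_minus inverse_eq_divide)
    show ?thesis unfolding c unfolding e(2)[symmetric] using e(1)
      by (simp add: divide_simps add_pos_pos)
  qed
  finally show ?thesis .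
qed

text \<open>Since \<open>Re (s + \<omega>) > 0\<close>, the factor \<open>1 / (s + \<omega>)\<close>
  is the integral of \<open>exp (- (s + \<omega>) * v)\<close> over \<open>v \<ge> 0\<close>. The
  part \<open>exp (- s * v)\<close> merges with \<open>y powr - s\<close> into
  \<open>(y * exp v) powr - s\<close>, and after Fubini the inner integral is
  \<open>sech_mellin\<close> at \<open>y * exp v\<close>.\<close>

lemma sech_mellin_stieltjes:
  fixes y \<sigma> :: real and \<omega> :: complex
  assumes y: "y > 0" and \<sigma>: "\<sigma> \<in> {1, -1}" and \<omega>: "Re \<omega> > - 1/2"
  defines "s \<equiv> \<lambda>u. 1/2 + of_real \<sigma> * \<i> * of_real u"
  shows "integrable lborel (\<lambda>u. of_real y powr (- s u) / ((s u + \<omega>) * of_real (cosh (pi * u))))" (is "integrable _ ?f")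
    and "(LINT u|lborel. of_real y powr (- s u) / ((s u + \<omega>) * of_real (cosh (pi * u)))) = 2 * stieltjes y \<omega>"
proof -
  have Re_s [simp]: "Re (s u) = 1/2" for u by (simp add: s_def)
  define h where "h = (\<lambda>u v. exp (- (s u + \<omega>) * of_real v) * (of_real y powr (- s u) / of_real (cosh (pi * u))))"
  define F where "F = (\<lambda>u v. indicator {0..} v *\<^sub>R h u v)"
  define c where "c = 1/2 + Re \<omega>"
  have c: "c > 0" unfolding c_def using \<omega> by simp
  \<comment> \<open>Writing \<open>y powr - s\<close> as an exponential makes the joint continuity,
    and hence the measurability, in both variables visible.\<close>
  have "case_prod h = (\<lambda>p. exp (- (s (fst p) + \<omega>) * of_real (snd p)) * (exp (- s (fst p) * of_real (ln y)) / of_real (cosh (pi * fst p))))"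
    unfolding h_def using y by (auto simp: fun_eq_iff powr_def Ln_of_real)
  moreover have "continuous_on UNIV (\<lambda>p. exp (- (s (fst p) + \<omega>) * of_real (snd p)) * (exp (- s (fst p) * of_real (ln y)) / of_real (cosh (pi * fst p))))"
    unfolding s_def by (intro continuous_intros) auto
  ultimately have mh: "case_prod h \<in> borel_measurable (lborel \<Otimes>\<^sub>M lborel)"
    by (simp add: lborel_prod borel_measurable_continuous_onI)
  have mF: "case_prod F \<in> borel_measurable (lborel \<Otimes>\<^sub>M lborel)"
  proof -
    have "(\<lambda>p. indicator {0..} (snd p) *\<^sub>R case_prod h p) \<in> borel_measurable (lborel \<Otimes>\<^sub>M lborel :: (real \<times> real) measure)"
      using mh by measurable
    then show ?thesis unfolding F_def by (simp add: split_beta')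
  qed
  \<comment> \<open>The norm separates into a function of \<open>v\<close> and a function of
    \<open>u\<close>, so the absolute integrability that Fubini needs reduces to one-dimensional
    integrals.\<close>
  have normF: "norm (F u v) = indicator {0..} v *\<^sub>R exp (- c * v) * (y powr (- 1/2) / cosh (pi * u))" for u v
    using y by (auto simp: F_def h_def norm_mult norm_divide norm_powr_real_powr c_def indicator_def algebra_simps)
  have inner_int: "integrable lborel (F u)" for u
  proof -
    have "integrable lborel (\<lambda>v. indicator {0..} v *\<^sub>R exp (- (s u + \<omega>) * of_real v) * (of_real y powr (- s u) / of_real (cosh (pi * u))))"
      by (intro integrable_mult_left integrable_exp_half_line_complex) (use c in \<open>simp add: c_def\<close>)
    then show ?thesis unfolding F_def h_def mult_scaleR_left .
  qed
  have inner_val: "(LINT v|lborel. F u v) = ?f u" for u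
  proof -
    have "(LINT v|lborel. F u v) = (LINT v|lborel. indicator {0..} v *\<^sub>R exp (- (s u + \<omega>) * of_real v) * (of_real y powr (- s u) / of_real (cosh (pi * u))))"
      unfolding F_def h_def mult_scaleR_left ..
    also have "\<dots> = 1 / (s u + \<omega>) * (of_real y powr (- s u) / of_real (cosh (pi * u)))"
      unfolding integral_mult_left_zero by (subst integral_exp_half_line) (use c in \<open>auto simp: c_def\<close>)
    finally show ?thesis by simp
  qed
  have intF: "integrable (lborel \<Otimes>\<^sub>M lborel) (case_prod F)"
  proof (rule lborel_pair.Fubini_integrable[OF mF])
    have "integrable lborel (\<lambda>u. (LINT v|lborel. indicator {0..} v *\<^sub>R exp (- c * v)) * (y powr (- 1/2) * (1 / cosh (pi * u))))"
      by (intro integrable_mult_right integrable_inverse_cosh)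
    then show "integrable lborel (\<lambda>x. LINT v|lborel. norm (case (x, v) of (x, xa) \<Rightarrow> F x xa))"
      by (simp add: normF)
  qed (simp add: inner_int)
  show "integrable lborel ?f"
    using lborel_pair.integrable_fst'[OF intF] by (simp add: inner_val)
  have "(LINT u|lborel. ?f u) = (LINT u|lborel. LINT v|lborel. F u v)" by (simp add: inner_val)
  also have "\<dots> = (LINT v|lborel. LINT u|lborel. F u v)"
    by (rule lborel_pair.Fubini_integral[OF intF, symmetric])
  also have "\<dots> = (LINT v|lborel. 2 * (indicator {0..} v *\<^sub>R (exp (- \<omega> * of_real v) / of_real (1 + y * exp v))))"
  proof (rule Bochner_Integration.integral_cong[OF refl])
    fix v
    have pw: "exp (- (s u + \<omega>) * of_real v) * of_real y powr (- s u) = exp (- \<omega> * of_real v) * of_real (y * exp v) powr (- s u)" for u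
      using y by (simp add: powr_def Ln_of_real ln_mult exp_add[symmetric] del: of_real_mult)
        (rule arg_cong[where f = exp], simp add: algebra_simps)
    have Fu: "F u v = (indicator {0..} v *\<^sub>R exp (- \<omega> * of_real v)) * (of_real (y * exp v) powr (- s u) / of_real (cosh (pi * u)))" for u
      using pw[of u] unfolding F_def h_def by (simp only: times_divide_eq_right scaleR_conv_of_real mult.assoc)
    have "(LINT u|lborel. F u v) = (LINT u|lborel. (indicator {0..} v *\<^sub>R exp (- \<omega> * of_real v)) * (of_real (y * exp v) powr (- s u) / of_real (cosh (pi * u))))"
      unfolding Fu ..
    also have "\<dots> = (indicator {0..} v *\<^sub>R exp (- \<omega> * of_real v)) * of_real (2 / (1 + y * exp v))"
      unfolding integral_mult_right_zero s_def using y \<sigma> by (subst sech_mellin) auto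
    finally show "(LINT u|lborel. F u v) = 2 * (indicator {0..} v *\<^sub>R (exp (- \<omega> * of_real v) / of_real (1 + y * exp v)))"
      by (simp add: scaleR_conv_of_real)
  qed
  also have "\<dots> = 2 * stieltjes y \<omega>" unfolding stieltjes_def by (rule integral_mult_right_zero)
  finally show "(LINT u|lborel. ?f u) = 2 * stieltjes y \<omega>" .
qed

section \<open>Special values and growth of \<open>stieltjes\<close>\<close>

text \<open>An antiderivative of the integrand is \<open>- ln (1 + y * exp (- v))\<close>. With
  \<open>y = N\<close> this evaluates the part with \<open>1 / (1 - s)\<close> in the partial
  fractions and is the source of the logarithm in Euler's constant.\<close>

lemma stieltjes_zero_inverse:
  assumes "y > 0"
  shows "stieltjes (1 / y) 0 = of_real (ln (1 + y))"
proof -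
  define f where "f = (\<lambda>v. 1 / (1 + exp v / y))"
  have pos: "1 + exp v / y > 0" for v using assms by (intro add_pos_nonneg) auto
  have f0: "f v \<ge> 0" and fle: "f v \<le> y * exp (- v)" for v
  proof -
    show "f v \<ge> 0" unfolding f_def using pos[of v] by simp
    have "f v \<le> 1 / (exp v / y)" unfolding f_def using assms by (intro frac_le) auto
    then show "f v \<le> y * exp (- v)" by (simp add: exp_minus inverse_eq_divide)
  qed
  have cont: "continuous_on S f" for S unfolding f_def using pos assms
    by (intro continuous_intros) (auto simp: less_imp_neq[symmetric])
  have int: "integrable lborel (\<lambda>v. indicator {0..} v *\<^sub>R f v)"
  proof (rule Bochner_Integration.integrable_bound)
    show "integrable lborel (\<lambda>v. y * (indicator {0..} v *\<^sub>R exp (- 1 * v)))"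
      by (intro integrable_mult_right integrable_exp_half_line) simp
    show "AE v in lborel. norm (indicator {0..} v *\<^sub>R f v) \<le> norm (y * (indicator {0..} v *\<^sub>R exp (- 1 * v)))"
      using f0 fle assms by (intro AE_I2) (auto simp: indicator_def)
    show "(\<lambda>v. indicator {0..} v *\<^sub>R f v) \<in> borel_measurable lborel"
      using cont[of UNIV] by (intro borel_measurable_scaleR) (auto simp: borel_measurable_continuous_onI)
  qed
  have "(LINT v|lborel. indicator {0..} v *\<^sub>R f v) = - ln (1 + y * 0) - - ln (1 + y * exp (- 0))"
  proof (rule integral_half_line_FTC[OF int cont])
    show "((\<lambda>v. - ln (1 + y * exp (- v))) has_vector_derivative f v) (at v)" for v
    proof -
      have "1 + y * exp (- v) > 0" using assms by (intro add_pos_nonneg) auto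
      then have "((\<lambda>v. - ln (1 + y * exp (- v))) has_real_derivative y * exp (- v) / (1 + y * exp (- v))) (at v)"
        by (auto intro!: derivative_eq_intros)
      also have "y * exp (- v) / (1 + y * exp (- v)) = f v"
        unfolding f_def using assms pos[of v] by (simp add: exp_minus field_simps)
      finally show ?thesis by (simp add: has_real_derivative_iff_has_vector_derivative)
    qed
    show "(\<lambda>n. - ln (1 + y * exp (- real n))) \<longlonglongrightarrow> - ln (1 + y * 0)"
      by real_asymp
  qed
  then have "(LINT v|lborel. indicator {0..} v *\<^sub>R f v) = ln (1 + y)" by simp
  moreover have "stieltjes (1 / y) 0 = (LINT v|lborel. of_real (indicator {0..} v *\<^sub>R f v))"
    unfolding stieltjes_def f_def by (intro Bochner_Integration.integral_cong) (auto simp: indicator_def)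
  ultimately show ?thesis by (simp only: integral_complex_of_real)
qed

lemma integrable_stieltjes:
  assumes "Re \<omega> > - 1" "y > 0"
  shows "integrable lborel (\<lambda>v. indicator {0..} v *\<^sub>R (exp (- \<omega> * of_real v) / of_real (1 + y * exp v)))"
proof (rule Bochner_Integration.integrable_bound)
  show "integrable lborel (\<lambda>v. 1 / y * (indicator {0..} v *\<^sub>R exp (- (Re \<omega> + 1) * v)))"
    using assms by (intro integrable_mult_right integrable_exp_half_line) simp
  have pos: "1 + y * exp v > 0" for v using assms by (intro add_pos_nonneg) auto
  have "continuous_on UNIV (\<lambda>v. exp (- \<omega> * of_real v) / complex_of_real (1 + y * exp v))"
    using pos by (intro continuous_intros) (metis less_irrefl of_real_eq_0_iff)
  then show "(\<lambda>v. indicator {0..} v *\<^sub>R (exp (- \<omega> * of_real v) / complex_of_real (1 + y * exp v))) \<in> borel_measurable lborel"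
    by (intro borel_measurable_scaleR) (auto simp: borel_measurable_continuous_onI)
  show "AE v in lborel. norm (indicator {0..} v *\<^sub>R (exp (- \<omega> * of_real v) / complex_of_real (1 + y * exp v))) \<le>
     norm (1 / y * (indicator {0..} v *\<^sub>R exp (- (Re \<omega> + 1) * v)))"
  proof (intro AE_I2)
    fix v :: real
    have "norm (exp (- \<omega> * of_real v) / complex_of_real (1 + y * exp v)) = exp (- Re \<omega> * v) / (1 + y * exp v)"
      unfolding norm_divide norm_of_real using pos[of v] by simp
    also have "\<dots> \<le> exp (- Re \<omega> * v) / (y * exp v)" using assms pos[of v] by (intro divide_left_mono mult_pos_pos) auto
    also have "\<dots> = 1 / y * exp (- (Re \<omega> + 1) * v)"
      by (simp add: algebra_simps exp_diff exp_minus exp_add divide_simps)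
    finally show "norm (indicator {0..} v *\<^sub>R (exp (- \<omega> * of_real v) / complex_of_real (1 + y * exp v))) \<le>
        norm (1 / y * (indicator {0..} v *\<^sub>R exp (- (Re \<omega> + 1) * v)))"
      using assms by (auto simp: indicator_def)
  qed
qed

text \<open>The quotient \<open>N / (1 + N * exp v)\<close> is bounded by \<open>exp (- v)\<close>
  and tends to it, so dominated convergence leaves the integral of
  \<open>exp (- (\<omega> + 1) * v)\<close>.\<close>

lemma stieltjes_large:
  assumes \<omega>: "Re \<omega> > - 1"
  shows "(\<lambda>N. of_nat N * stieltjes (real N) \<omega>) \<longlonglongrightarrow> 1 / (\<omega> + 1)"
proof -
  define g where "g = (\<lambda>(N::nat) v. indicator {0..} v *\<^sub>R (of_nat N * (exp (- \<omega> * of_real v) / of_real (1 + real N * exp v))))"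
  have pos: "1 + real N * exp v > 0" for N v by (intro add_pos_nonneg) auto
  have "(\<lambda>N. LINT v|lborel. g N v) \<longlonglongrightarrow> (LINT v|lborel. indicator {0..} v *\<^sub>R exp (- (\<omega> + 1) * of_real v))"
  proof (rule integral_dominated_convergence)
    show "integrable lborel (\<lambda>v. indicator {0..} v *\<^sub>R exp (- (Re \<omega> + 1) * v))"
      using \<omega> by (intro integrable_exp_half_line) simp
    show "(\<lambda>v. indicator {0..} v *\<^sub>R exp (- (\<omega> + 1) * of_real v)) \<in> borel_measurable lborel"
      using \<omega> by (intro borel_measurable_integrable integrable_exp_half_line_complex) simp
    show "g N \<in> borel_measurable lborel" for N
    proof (cases "N = 0")
      case False
      then have "integrable lborel (\<lambda>v. of_nat N * (indicator {0..} v *\<^sub>R (exp (- \<omega> * of_real v) / of_real (1 + real N * exp v))))"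
        using \<omega> by (intro integrable_mult_right integrable_stieltjes) auto
      then show ?thesis unfolding g_def by (intro borel_measurable_integrable) simp
    qed (simp add: g_def)
    show "AE v in lborel. norm (g N v) \<le> indicator {0..} v *\<^sub>R exp (- (Re \<omega> + 1) * v)" for N
    proof (intro AE_I2)
      fix v :: real
      have "norm (of_nat N * (exp (- \<omega> * of_real v) / complex_of_real (1 + real N * exp v))) = real N * exp (- Re \<omega> * v) / (1 + real N * exp v)"
        unfolding norm_divide norm_of_real norm_mult using pos[of N v] by simp
      also have "\<dots> = exp (- Re \<omega> * v) * (real N / (1 + real N * exp v))" by simp
      also have "\<dots> \<le> exp (- Re \<omega> * v) * exp (- v)"
        using pos[of N v] by (intro mult_left_mono) (simp_all add: exp_minus field_simps)
      also have "\<dots> = exp (- (Re \<omega> + 1) * v)" by (simp add: algebra_simps flip: exp_add)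
      finally show "norm (g N v) \<le> indicator {0..} v *\<^sub>R exp (- (Re \<omega> + 1) * v)"
        unfolding g_def by (auto simp: indicator_def)
    qed
    show "AE v in lborel. (\<lambda>N. g N v) \<longlonglongrightarrow> indicator {0..} v *\<^sub>R exp (- (\<omega> + 1) * of_real v)"
    proof (intro AE_I2)
      fix v :: real
      have "(\<lambda>N. real N / (1 + real N * exp v)) \<longlonglongrightarrow> inverse (exp v)" by real_asymp
      then have "(\<lambda>N. indicator {0..} v *\<^sub>R (exp (- \<omega> * of_real v) * of_real (real N / (1 + real N * exp v)))) \<longlonglongrightarrow> indicator {0..} v *\<^sub>R (exp (- \<omega> * of_real v) * of_real (exp (- v)))"
        unfolding exp_minus[of v] by (intro tendsto_intros tendsto_of_real)
      also have "exp (- \<omega> * of_real v) * of_real (exp (- v)) = exp (- (\<omega> + 1) * of_real v)"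
        by (simp add: exp_of_real[symmetric] exp_add[symmetric] algebra_simps del: exp_of_real)
      finally show "(\<lambda>N. g N v) \<longlonglongrightarrow> indicator {0..} v *\<^sub>R exp (- (\<omega> + 1) * of_real v)"
        unfolding g_def by (simp add: mult.commute)
    qed
  qed
  moreover have "(LINT v|lborel. g N v) = of_nat N * stieltjes (real N) \<omega>" for N
    unfolding g_def stieltjes_def by (simp flip: integral_mult_right_zero)
  moreover have "(LINT v|lborel. indicator {0..} v *\<^sub>R exp (- (\<omega> + 1) * of_real v)) = 1 / (\<omega> + 1)"
    using \<omega> by (intro integral_exp_half_line) simp
  ultimately show ?thesis by simp
qed

subsection \<open>The series and the integral\<close>

lemma geometric_remainder:
  fixes q :: "'a :: field"
  assumes "1 + q \<noteq> 0"
  shows "(\<Sum>j=2..Suc M. (- q) ^ j) = q\<^sup>2 / (1 + q) - (- q) ^ (M + 2) / (1 + q)"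
proof (induction M)
  case (Suc M)
  have "(\<Sum>j=2..Suc (Suc M). (- q) ^ j) = (\<Sum>j=2..Suc M. (- q) ^ j) + (- q) ^ (M + 2)"
    by (subst sum.nat_ivl_Suc') (auto simp: add.commute)
  also have "\<dots> = q\<^sup>2 / (1 + q) + ((- q) ^ (M + 2) - (- q) ^ (M + 2) / (1 + q))"
    unfolding Suc.IH by simp
  also have "(- q) ^ (M + 2) - (- q) ^ (M + 2) / (1 + q) = - ((- q) ^ (Suc M + 2) / (1 + q))"
    using assms by (simp add: divide_simps) (simp add: algebra_simps)
  finally show ?case by simp
qed (simp add: power2_eq_square)

text \<open>Put \<open>q = exp (- v) / n\<close>. All three parts are integrals of
  \<open>exp (- \<omega> * v)\<close> against \<open>q\<close>, \<open>q / (1 + q)\<close> and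
  \<open>(- q) ^ j\<close>, so their difference is the integral of a geometric remainder. The
  remainder in closed form also covers \<open>q = 1\<close>, where the infinite geometric series
  diverges.\<close>

lemma nu_term_integral:
  fixes \<omega> :: complex
  assumes \<omega>: "Re \<omega> > - 1/2" and n: "n > 0"
  shows "norm (1 / (of_nat n * (\<omega> + 1)) - stieltjes (real n) \<omega> - (\<Sum>j=2..Suc M. (- 1) ^ j * (1 / of_nat n ^ j / (of_nat j + \<omega>))))
      \<le> 1 / real n ^ 2 * (1 / (Re \<omega> + real M + 2))"
proof -
  define e where "e = (\<lambda>a v. indicator {0..} v *\<^sub>R exp (- a * complex_of_real v))"
  have e_int: "integrable lborel (e a)" and e_val: "integral\<^sup>L lborel (e a) = 1 / a" if "Re a > 0" for a
    unfolding e_def using integrable_exp_half_line_complex[OF that] integral_exp_half_line[OF that] by simp_all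
  define k where "k = (\<lambda>v. indicator {0..} v *\<^sub>R (exp (- \<omega> * of_real v) / of_real (1 + real n * exp v)))"
  have k_int: "integrable lborel k" unfolding k_def using \<omega> n by (intro integrable_stieltjes) auto
  define D where "D = (\<lambda>v. 1 / of_nat n * e (\<omega> + 1) v - k v - (\<Sum>j=2..Suc M. (- 1) ^ j / of_nat n ^ j * e (of_nat j + \<omega>) v))"
  have i1: "integrable lborel (\<lambda>v. 1 / of_nat n * e (\<omega> + 1) v)"
    using \<omega> by (intro integrable_mult_right e_int) simp
  have i2: "integrable lborel (\<lambda>v. (- 1) ^ j / of_nat n ^ j * e (of_nat j + \<omega>) v)" if "j \<in> {2..Suc M}" for j
    using \<omega> that by (intro integrable_mult_right e_int) simp
  have i3: "integrable lborel (\<lambda>v. \<Sum>j=2..Suc M. (- 1) ^ j / of_nat n ^ j * e (of_nat j + \<omega>) v)"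
    using i2 by (rule Bochner_Integration.integrable_sum)
  have D_int: "integrable lborel D" unfolding D_def
    using Bochner_Integration.integrable_diff[OF Bochner_Integration.integrable_diff[OF i1 k_int] i3] .
  have "(LINT v|lborel. (\<Sum>j=2..Suc M. (- 1) ^ j / of_nat n ^ j * e (of_nat j + \<omega>) v)) = (\<Sum>j=2..Suc M. (- 1) ^ j / of_nat n ^ j * (1 / (of_nat j + \<omega>)))"
  proof (rule trans[OF Bochner_Integration.integral_sum[OF i2]])
    show "(\<Sum>j=2..Suc M. LINT v|lborel. (- 1) ^ j / of_nat n ^ j * e (of_nat j + \<omega>) v) = (\<Sum>j=2..Suc M. (- 1) ^ j / of_nat n ^ j * (1 / (of_nat j + \<omega>)))"
      unfolding integral_mult_right_zero using \<omega>
      by (intro sum.cong refl arg_cong2[where f = "(*)"] e_val) auto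
  qed
  moreover have "(LINT v|lborel. 1 / of_nat n * e (\<omega> + 1) v) = 1 / of_nat n * (1 / (\<omega> + 1))"
    unfolding integral_mult_right_zero using \<omega> by (subst e_val) auto
  moreover have "integral\<^sup>L lborel k = stieltjes (real n) \<omega>" unfolding k_def stieltjes_def ..
  ultimately have "integral\<^sup>L lborel D = 1 / of_nat n * (1 / (\<omega> + 1)) - stieltjes (real n) \<omega> - (\<Sum>j=2..Suc M. (- 1) ^ j / of_nat n ^ j * (1 / (of_nat j + \<omega>)))"
    unfolding D_def Bochner_Integration.integral_diff[OF Bochner_Integration.integrable_diff[OF i1 k_int] i3]
      Bochner_Integration.integral_diff[OF i1 k_int] by simp
  moreover have "norm (integral\<^sup>L lborel D) \<le> (LINT v|lborel. 1 / real n ^ 2 * (indicator {0..} v *\<^sub>R exp (- (Re \<omega> + real M + 2) * v)))"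
  proof (rule order.trans[OF integral_norm_bound integral_mono])
    show "integrable lborel (\<lambda>v. norm (D v))" using D_int by (rule integrable_norm)
    show "integrable lborel (\<lambda>v. 1 / real n ^ 2 * (indicator {0..} v *\<^sub>R exp (- (Re \<omega> + real M + 2) * v)))"
      using \<omega> by (intro integrable_mult_right integrable_exp_half_line) auto
    fix v :: real
    show "norm (D v) \<le> 1 / real n ^ 2 * (indicator {0..} v *\<^sub>R exp (- (Re \<omega> + real M + 2) * v))"
    proof (cases "v \<ge> 0")
      case True
      define q where "q = exp (- v) / real n"
      have q: "q > 0" unfolding q_def using n by simp
      define E where "E = exp (- \<omega> * of_real v)"
      have 1: "1 / of_nat n * e (\<omega> + 1) v = E * of_real q"
        using True by (simp add: e_def E_def q_def exp_of_real[symmetric] exp_add[symmetric] algebra_simps del: exp_of_real)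
      have 2: "k v = E * of_real (q / (1 + q))"
      proof -
        have "1 / (1 + real n * exp v) = q / (1 + q)"
          unfolding q_def using n by (simp add: exp_minus field_simps)
        moreover have "k v = E / of_real (1 + real n * exp v)" using True unfolding k_def E_def by simp
        then have "k v = E * of_real (1 / (1 + real n * exp v))"
          by (simp only: of_real_divide of_real_1 mult_1_right times_divide_eq_right)
        ultimately show ?thesis by simp
      qed
      have 3: "(- 1) ^ j / of_nat n ^ j * e (of_nat j + \<omega>) v = E * of_real ((- q) ^ j)" for j
      proof -
        have "e (of_nat j + \<omega>) v = E * of_real (exp (- v)) ^ j"
          using True by (simp add: e_def E_def exp_of_real[symmetric] exp_add[symmetric] exp_of_nat_mult[symmetric] algebra_simps del: exp_of_real)
        moreover have "(- q) ^ j = (- 1) ^ j / real n ^ j * exp (- v) ^ j"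
          unfolding q_def by (simp add: power_minus[of "_ / _"] power_divide)
        ultimately show ?thesis by simp
      qed
      have "D v = E * of_real (q - q / (1 + q) - (\<Sum>j=2..Suc M. (- q) ^ j))"
        unfolding D_def 1 2 3 by (simp only: of_real_diff right_diff_distrib sum_distrib_left of_real_sum)
      also have "q - q / (1 + q) - (\<Sum>j=2..Suc M. (- q) ^ j) = (- q) ^ (M + 2) / (1 + q)"
      proof -
        have "q - q / (1 + q) = q\<^sup>2 / (1 + q)" using q by (simp add: power2_eq_square field_simps)
        moreover have "1 + q \<noteq> 0" using q by simp
        ultimately show ?thesis unfolding geometric_remainder[OF \<open>1 + q \<noteq> 0\<close>] by linarith
      qed
      finally have "norm (D v) = norm E * \<bar>(- q) ^ (M + 2) / (1 + q)\<bar>"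
        by (simp only: norm_mult norm_of_real)
      also have "norm E = exp (- Re \<omega> * v)" by (simp add: E_def)
      also have "\<bar>(- q) ^ (M + 2) / (1 + q)\<bar> = q ^ (M + 2) / (1 + q)"
        unfolding abs_divide power_abs abs_minus_cancel using q by simp
      finally have nD: "norm (D v) = exp (- Re \<omega> * v) * (q ^ (M + 2) / (1 + q))" .
      have "q ^ (M + 2) / (1 + q) \<le> q ^ (M + 2) / 1"
        using q by (intro divide_left_mono) auto
      also have "\<dots> = exp (- v) ^ (M + 2) / real n ^ (M + 2)" unfolding q_def by (simp add: power_divide)
      \<comment> \<open>Two powers of \<open>1 / n\<close> suffice for summability over
        \<open>n\<close>; the exponential keeps the full exponent, which gives the decay in
        \<open>M\<close>.\<close>
      also have "\<dots> \<le> exp (- v) ^ (M + 2) / real n ^ 2"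
        using n by (intro divide_left_mono power_increasing) auto
      also have "exp (- v) ^ (M + 2) = exp (- (real M + 2) * v)"
        by (simp add: algebra_simps flip: exp_of_nat_mult exp_add)
      finally have "norm (D v) \<le> exp (- Re \<omega> * v) * (exp (- (real M + 2) * v) / real n ^ 2)"
        unfolding nD by (intro mult_left_mono) auto
      also have "\<dots> = 1 / real n ^ 2 * exp (- (Re \<omega> + real M + 2) * v)"
      proof -
        have "exp (- Re \<omega> * v) * exp (- (real M + 2) * v) = exp (- (Re \<omega> + real M + 2) * v)"
          unfolding exp_add[symmetric] by (rule arg_cong[where f = exp]) (simp add: algebra_simps)
        then show ?thesis by simp
      qed
      finally show ?thesis using True by simp
    qed (simp add: D_def e_def k_def)
  qed
  moreover have "(LINT v|lborel. 1 / real n ^ 2 * (indicator {0..} v *\<^sub>R exp (- (Re \<omega> + real M + 2) * v))) = 1 / real n ^ 2 * (1 / (Re \<omega> + real M + 2))"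
  proof -
    define a where "a = Re \<omega> + real M + 2"
    have a: "a > 0" unfolding a_def using \<omega> by auto
    have "(LINT v|lborel. indicator {0..} v *\<^sub>R exp (- a * v)) = - 0 / a - - exp (- a * 0) / a"
    proof (rule integral_half_line_FTC[OF integrable_exp_half_line[OF a]])
      show "((\<lambda>v. - exp (- a * v) / a) has_vector_derivative exp (- a * v)) (at v)" for v
        using a by (auto intro!: derivative_eq_intros simp: has_real_derivative_iff_has_vector_derivative[symmetric])
      show "(\<lambda>n. - exp (- a * real n) / a) \<longlonglongrightarrow> - 0 / a" using a by real_asymp
    qed (auto intro!: continuous_intros)
    then show ?thesis unfolding integral_mult_right_zero a_def[symmetric] by simp
  qed
  moreover have "(- 1) ^ j * (1 / of_nat n ^ j / (of_nat j + \<omega>)) = (- 1) ^ j / of_nat n ^ j * (1 / (of_nat j + \<omega>))" for j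
    by simp
  moreover have "1 / (of_nat n * (\<omega> + 1)) = 1 / of_nat n * (1 / (\<omega> + 1))" by simp
  ultimately show ?thesis by (simp only:)
qed

text \<open>The sums over \<open>j\<close> and \<open>n\<close> cannot be exchanged by absolute
  convergence, because \<open>zeta j / (j + \<omega>)\<close> decays only like \<open>1 / j\<close>.
  Instead, for each cutoff \<open>M\<close> the finite sum over \<open>j\<close> is exchanged
  exactly, and the error, summed over \<open>n\<close>, is of order \<open>1 / M\<close>.\<close>

lemma nu_limit:
  fixes \<omega> :: complex
  assumes \<omega>: "Re \<omega> > - 1/2"
  obtains L where "nu_partial \<omega> \<longlonglongrightarrow> L"
    "(\<lambda>N. \<Sum>n<N. 1 / (of_nat (Suc n) * (\<omega> + 1)) - stieltjes (real (Suc n)) \<omega>) \<longlonglongrightarrow> L"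
proof -
  define a where "a = (\<lambda>n. 1 / (of_nat (Suc n) * (\<omega> + 1)) - stieltjes (real (Suc n)) \<omega>)"
  define b where "b = (\<lambda>M n. \<Sum>j=2..Suc M. (- 1) ^ j * (1 / of_nat (Suc n) ^ j / (of_nat j + \<omega>)))"
  define z where "z = (\<lambda>n. 1 / real (Suc n) ^ 2)"
  have z: "summable z" unfolding z_def
    using inverse_squares_sums by (auto simp: sums_iff)
  have ab: "norm (a n - b M n) \<le> z n * (1 / (Re \<omega> + real M + 2))" for n M
    unfolding a_def b_def z_def by (rule nu_term_integral[OF \<omega>]) simp
  have b_sums: "b M sums nu_partial \<omega> (Suc M)" for M
    unfolding b_def nu_partial_def
  proof (intro sums_sum sums_mult)
    fix j assume "j \<in> {2..Suc M}"
    then have "(\<lambda>n. 1 / of_nat (Suc n) powr of_nat j) sums riemann_zeta (of_nat j)"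
      by (intro riemann_zeta_sums) auto
    then have "(\<lambda>n. 1 / of_nat (Suc n) ^ j) sums riemann_zeta (of_nat j)"
      using \<open>j \<in> {2..Suc M}\<close> by (simp add: powr_nat' del: of_nat_Suc)
    then show "(\<lambda>n. 1 / of_nat (Suc n) ^ j / (of_nat j + \<omega>)) sums (riemann_zeta (of_nat j) / (of_nat j + \<omega>))"
      by (rule sums_divide)
  qed
  have sd: "summable (\<lambda>n. a n - b M n)" for M
    by (rule summable_comparison_test'[where N = 0, OF summable_mult2[OF z]]) (rule ab)
  \<comment> \<open>For \<open>M = 0\<close> the sum over \<open>j\<close> is empty, so this case of
    \<open>sd\<close> already concerns \<open>a\<close> alone.\<close>
  have a: "summable a" using summable_add[OF sd[of 0] sums_summable[OF b_sums[of 0]]] by simp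
  have bound: "norm (suminf a - nu_partial \<omega> (Suc M)) \<le> suminf z * (1 / (Re \<omega> + real M + 2))" for M
  proof -
    have "suminf a - nu_partial \<omega> (Suc M) = (\<Sum>n. a n - b M n)"
      using suminf_diff[OF a sums_summable[OF b_sums[of M]]] sums_unique[OF b_sums[of M]] by simp
    also have "norm \<dots> \<le> (\<Sum>n. z n * (1 / (Re \<omega> + real M + 2)))"
      by (rule norm_suminf_le[OF ab summable_mult2[OF z]])
    finally show ?thesis unfolding suminf_mult2[OF z] .
  qed
  have "(\<lambda>M. suminf z * (1 / (Re \<omega> + real M + 2))) \<longlonglongrightarrow> 0"
    by (rule tendsto_eq_rhs[OF tendsto_mult_right_zero refl]) real_asymp
  then have "(\<lambda>M. suminf a - nu_partial \<omega> (Suc M)) \<longlonglongrightarrow> 0"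
    by (rule Lim_null_comparison[rotated]) (use bound in auto)
  from tendsto_diff[OF tendsto_const[of "suminf a"] this] have "(\<lambda>M. nu_partial \<omega> (Suc M)) \<longlonglongrightarrow> suminf a" by simp
  then have "nu_partial \<omega> \<longlonglongrightarrow> suminf a" by (rule LIMSEQ_imp_Suc)
  moreover have "(\<lambda>N. \<Sum>n<N. a n) \<longlonglongrightarrow> suminf a" using a by (rule summable_LIMSEQ)
  ultimately show thesis unfolding a_def by (rule that)
qed

section \<open>The integral over the critical line\<close>

text \<open>Each \<open>n powr - s\<close> contributes \<open>2 * stieltjes n \<omega>\<close>. In
  the correction term, \<open>1 / ((1 - s) * (s + \<omega>))\<close> is
  \<open>1 / (\<omega> + 1)\<close> times \<open>1 / (1 - s) + 1 / (s + \<omega>)\<close>; the first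
  part yields the logarithm, the second the term with
  \<open>N * stieltjes N \<omega>\<close>.\<close>

lemma zeta_approx_integral:
  fixes \<omega> :: complex and \<sigma> :: real
  assumes \<omega>: "Re \<omega> > - 1/2" and \<sigma>: "\<sigma> \<in> {1, -1}" and N: "N > 0"
  defines "s \<equiv> \<lambda>u. 1/2 + of_real \<sigma> * \<i> * of_real u"
  defines "f \<equiv> \<lambda>u. ((\<Sum>n<N. 1 / of_nat (Suc n) powr s u) - of_nat N powr (1 - s u) / (1 - s u)) / ((s u + \<omega>) * of_real (cosh (pi * u)))"
  shows "integrable lborel f"
    and "integral\<^sup>L lborel f = 2 * (\<Sum>n<N. stieltjes (real (Suc n)) \<omega>)
      - 2 * (of_real (ln (1 + real N)) + of_nat N * stieltjes (real N) \<omega>) / (\<omega> + 1)"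
proof -
  define C where "C = (\<lambda>u. complex_of_real (cosh (pi * u)))"
  have C0: "C u \<noteq> 0" for u unfolding C_def by simp
  have Re_s: "Re (s u) = 1/2" for u by (simp add: s_def)
  have s0: "s u + \<omega> \<noteq> 0" "1 - s u \<noteq> 0" "\<omega> + 1 \<noteq> 0" for u
    using Re_s[of u] \<omega> by (auto simp: complex_eq_iff)
  define p where "p = (\<lambda>n u. of_real (real n) powr (- s u) / ((s u + \<omega>) * C u))"
  have p: "integrable lborel (p n)" "integral\<^sup>L lborel (p n) = 2 * stieltjes (real n) \<omega>" if "n > 0" for n
    using sech_mellin_stieltjes[OF _ \<sigma> \<omega>, where y = "real n"] that unfolding p_def C_def s_def by auto
  define r where "r = (\<lambda>u. of_real (1 / real N) powr (- (1 - s u)) / ((1 - s u + 0) * C u))"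
  \<comment> \<open>The reflection of \<open>s\<close> to \<open>1 - s\<close> preserves the
    critical line and reverses the sign \<open>\<sigma>\<close>. Hence \<open>r\<close> is an
    instance of the same integral with \<open>- \<sigma>\<close>, \<open>y = 1 / N\<close> and
    \<open>\<omega> = 0\<close>.\<close>
  have s1: "1 - s u = 1/2 + of_real (- \<sigma>) * \<i> * of_real u" for u by (simp add: s_def)
  have \<sigma>': "- \<sigma> \<in> {1, -1}" using \<sigma> by auto
  have r: "integrable lborel r" "integral\<^sup>L lborel r = 2 * of_real (ln (1 + real N))"
    using sech_mellin_stieltjes[OF _ \<sigma>', where y = "1 / real N" and \<omega> = 0] N stieltjes_zero_inverse
    unfolding r_def C_def s1 by auto
  have f_eq: "f u = (\<Sum>n<N. p (Suc n) u) - 1 / (\<omega> + 1) * (r u + of_nat N * p N u)" for u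
  proof -
    have i: "of_real (1 / real N) powr (- (1 - s u)) = of_nat N powr (1 - s u)"
      using N by (simp add: powr_def Ln_of_real ln_div Ln_of_nat del: of_real_divide)
        (rule arg_cong[where f = exp], simp add: algebra_simps)
    have ii: "of_nat N powr (1 - s u) = of_nat N * of_real (real N) powr (- s u)"
      using N by (simp add: powr_diff powr_minus divide_simps)
    have iii: "1 / ((1 - s u) * (s u + \<omega>)) = 1 / (\<omega> + 1) * (1 / (1 - s u) + 1 / (s u + \<omega>))"
      using s0(1,2)[of u] s0(3) by (simp add: divide_simps)
    have alg: "p / c * (1 / w * (1 / x + 1 / y)) = 1 / w * (p / (x * c) + p / (y * c))" for p c w x y :: complex
      by (simp add: divide_inverse distrib_left mult_ac)
    have "of_nat N powr (1 - s u) / (1 - s u) / ((s u + \<omega>) * C u) = of_nat N powr (1 - s u) / C u * (1 / ((1 - s u) * (s u + \<omega>)))"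
      by simp
    also have "\<dots> = 1 / (\<omega> + 1) * (of_nat N powr (1 - s u) / ((1 - s u) * C u) + of_nat N powr (1 - s u) / ((s u + \<omega>) * C u))"
      unfolding iii by (rule alg)
    also have "of_nat N powr (1 - s u) / ((1 - s u) * C u) = r u" unfolding r_def i by simp
    also have "of_nat N powr (1 - s u) / ((s u + \<omega>) * C u) = of_nat N * p N u" unfolding p_def ii by simp
    finally have "of_nat N powr (1 - s u) / (1 - s u) / ((s u + \<omega>) * C u) = 1 / (\<omega> + 1) * (r u + of_nat N * p N u)" .
    moreover have "of_real (cosh (pi * u)) = C u" by (simp add: C_def)
    ultimately show ?thesis unfolding f_def diff_divide_distrib p_def
      by (simp add: sum_divide_distrib powr_minus_divide del: of_nat_Suc)
  qed
  have ff: "f = (\<lambda>u. (\<Sum>n<N. p (Suc n) u) - 1 / (\<omega> + 1) * (r u + of_nat N * p N u))" using f_eq by auto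
  have i1: "integrable lborel (\<lambda>u. \<Sum>n<N. p (Suc n) u)" using p(1) by (intro Bochner_Integration.integrable_sum) auto
  have i2: "integrable lborel (\<lambda>u. r u + of_nat N * p N u)" using p(1)[OF N] r(1) by simp
  show "integrable lborel f" unfolding ff using i1 i2 by simp
  have "integral\<^sup>L lborel f = (\<Sum>n<N. integral\<^sup>L lborel (p (Suc n))) - 1 / (\<omega> + 1) * (integral\<^sup>L lborel r + of_nat N * integral\<^sup>L lborel (p N))"
    unfolding ff using p(1) p(1)[OF N] r(1) i1 i2 by simp
  then show "integral\<^sup>L lborel f = 2 * (\<Sum>n<N. stieltjes (real (Suc n)) \<omega>)
      - 2 * (of_real (ln (1 + real N)) + of_nat N * stieltjes (real N) \<omega>) / (\<omega> + 1)"
    using p(2)[OF N] r(2) by (simp add: p(2) sum_distrib_left algebra_simps add_divide_distrib del: of_nat_Suc)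
qed

theorem theorem1:
  fixes \<omega> :: complex and \<sigma> :: real
  assumes "Re \<omega> > - 1/2"
    and "\<sigma> \<in> {1, -1}"
  shows "convergent (nu_partial \<omega>) \<and>
    integrable lborel (nu_integrand \<sigma> \<omega>) \<and>
    nu \<omega> = - 1 / (\<omega> + 1)\<^sup>2 + euler_mascheroni / (\<omega> + 1)
             - 1/2 * (LINT x|lborel. nu_integrand \<sigma> \<omega> x)"
proof -
  note \<omega> = assms(1)
  define s where "s = (\<lambda>u. 1/2 + of_real \<sigma> * \<i> * complex_of_real u)"
  define H where "H = (\<lambda>N u. (\<Sum>n<N. 1 / of_nat (Suc n) powr s u) - of_nat N powr (1 - s u) / (1 - s u))"
  \<comment> \<open>The index \<open>Suc N\<close> avoids the empty partial sum, since the bound and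
    the value of the integral are available only for positive cutoffs.\<close>
  define f where "f = (\<lambda>N u. H (Suc N) u / ((s u + \<omega>) * of_real (cosh (pi * u))))"
  define c where "c = 1/2 + Re \<omega>"
  have c: "c > 0" unfolding c_def using \<omega> by simp
  have Re_s: "Re (s u) = 1/2" for u by (simp add: s_def)
  have s1: "s u \<noteq> 1" "s u + \<omega> \<noteq> 0" for u
    using Re_s[of u] \<omega> by (auto simp: complex_eq_iff)
  have \<omega>1: "\<omega> + 1 \<noteq> 0" using \<omega> by (auto simp: complex_eq_iff)
  obtain C where C: "C \<ge> 0" "\<And>s N. Re s = 1/2 \<Longrightarrow>
    norm ((s - 1) * (\<Sum>n<Suc N. 1 / of_nat (Suc n) powr s) + of_nat (Suc N) powr (1 - s)) \<le> norm s * (1 + C * norm (s - 1))"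
    using zeta_approx_bound by metis
  have H_le: "norm (H (Suc N) u) \<le> 1 + C * norm (s u)" for N u
  proof -
    \<comment> \<open>The critical line is equidistant from 0 and 1; the factor
      \<open>norm s\<close> in the bound therefore cancels against the division by
      \<open>s - 1\<close>.\<close>
    have ns: "norm (s u - 1) = norm (s u)" 
      unfolding cmod_def by (simp only: minus_complex.sel one_complex.sel Re_s) (simp add: power2_eq_square)
    have s0: "norm (s u) > 0" using Re_s[of u] by auto
    have "H (Suc N) u = ((s u - 1) * (\<Sum>n<Suc N. 1 / of_nat (Suc n) powr s u) + of_nat (Suc N) powr (1 - s u)) / (s u - 1)"
      unfolding H_def using s1[of u] by (simp add: divide_simps del: sum.lessThan_Suc of_nat_Suc) (simp add: algebra_simps del: sum.lessThan_Suc of_nat_Suc)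
    then have "norm (H (Suc N) u) = norm ((s u - 1) * (\<Sum>n<Suc N. 1 / of_nat (Suc n) powr s u) + of_nat (Suc N) powr (1 - s u)) / norm (s u)"
      by (simp only: norm_divide ns)
    also have "\<dots> \<le> norm (s u) * (1 + C * norm (s u)) / norm (s u)"
      using C(2)[OF Re_s[of u], of N] unfolding ns by (intro divide_right_mono) auto
    finally show ?thesis using s0 by simp
  qed
  \<comment> \<open>The linear growth of \<open>H\<close> is absorbed by the denominator
    \<open>s u + \<omega>\<close>, using
    \<open>norm (s u) \<le> norm (s u + \<omega>) + norm \<omega>\<close> and
    \<open>norm (s u + \<omega>) \<ge> c\<close>.\<close>
  define B where "B = C + (1 + C * norm \<omega>) / c"
  have f_le: "norm (f N u) \<le> B * (1 / cosh (pi * u))" for N u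
  proof -
    have cs: "c \<le> norm (s u + \<omega>)" using complex_Re_le_cmod[of "s u + \<omega>"] Re_s[of u] by (simp add: c_def)
    have "norm (s u) \<le> norm (s u + \<omega>) + norm \<omega>" using norm_triangle_ineq4[of "s u + \<omega>" \<omega>] by simp
    then have "norm (H (Suc N) u) \<le> 1 + C * (norm (s u + \<omega>) + norm \<omega>)"
      using H_le[of N u] C(1) by (meson add_left_mono mult_left_mono order_trans)
    then have "norm (H (Suc N) u) / norm (s u + \<omega>) \<le> (1 + C * (norm (s u + \<omega>) + norm \<omega>)) / norm (s u + \<omega>)"
      by (intro divide_right_mono) auto
    also have "\<dots> = C + (1 + C * norm \<omega>) / norm (s u + \<omega>)"
      using s1(2)[of u] by (simp add: field_simps)
    also have "\<dots> \<le> B" unfolding B_def using c cs C(1)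
      by (intro add_left_mono divide_left_mono mult_pos_pos) auto
    finally have "norm (H (Suc N) u) / norm (s u + \<omega>) * (1 / cosh (pi * u)) \<le> B * (1 / cosh (pi * u))"
      by (intro mult_right_mono) auto
    then show ?thesis unfolding f_def by (simp add: norm_divide norm_mult)
  qed
  have f_lim: "(\<lambda>N. f N u) \<longlonglongrightarrow> nu_integrand \<sigma> \<omega> u" for u
  proof -
    have "(\<lambda>N. H N u) \<longlonglongrightarrow> riemann_zeta (s u)"
      unfolding H_def using s1(1)[of u] Re_s[of u] by (intro riemann_zeta_LIMSEQ) auto
    then have "(\<lambda>N. H (Suc N) u) \<longlonglongrightarrow> riemann_zeta (s u)" by (rule LIMSEQ_Suc)
    then show ?thesis unfolding f_def nu_integrand_def s_def[symmetric]
      using s1(2)[of u] by (intro tendsto_intros) (auto simp: s_def)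
  qed
  have f_int: "integrable lborel (f N)" and f_val: "integral\<^sup>L lborel (f N) = 2 * (\<Sum>n<Suc N. stieltjes (real (Suc n)) \<omega>)
      - 2 * (of_real (ln (1 + real (Suc N))) + of_nat (Suc N) * stieltjes (real (Suc N)) \<omega>) / (\<omega> + 1)" for N
    unfolding f_def H_def s_def using zeta_approx_integral[OF assms, of "Suc N"] by simp_all
  have f_meas: "f N \<in> borel_measurable lborel" for N using f_int by (rule borel_measurable_integrable)
  have g_meas: "nu_integrand \<sigma> \<omega> \<in> borel_measurable lborel"
    by (rule borel_measurable_LIMSEQ_metric[OF f_meas f_lim])
  have Bint: "integrable lborel (\<lambda>u. B * (1 / cosh (pi * u)))"
    by (intro integrable_mult_right integrable_inverse_cosh)
  have int: "integrable lborel (nu_integrand \<sigma> \<omega>)"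
    by (rule integrable_dominated_convergence[where s = f, OF g_meas f_meas Bint]) (use f_lim f_le in auto)
  define I where "I = (LINT x|lborel. nu_integrand \<sigma> \<omega> x)"
  have "(\<lambda>N. integral\<^sup>L lborel (f N)) \<longlonglongrightarrow> I" unfolding I_def
    by (rule integral_dominated_convergence[where s = f, OF g_meas f_meas Bint]) (use f_lim f_le in auto)
  moreover obtain L where L: "nu_partial \<omega> \<longlonglongrightarrow> L"
    "(\<lambda>N. \<Sum>n<N. 1 / (of_nat (Suc n) * (\<omega> + 1)) - stieltjes (real (Suc n)) \<omega>) \<longlonglongrightarrow> L"
    using nu_limit[OF \<omega>] by blast
  \<comment> \<open>The integral produces \<open>ln (1 + real (Suc N))\<close> where the limit
    defining Euler's constant has \<open>ln (real (Suc N))\<close>; the difference tends to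
    0.\<close>
  have harm: "(\<lambda>N. complex_of_real (harm (Suc N) - ln (1 + real (Suc N)))) \<longlonglongrightarrow> euler_mascheroni"
  proof -
    have "(\<lambda>N. ln (real (Suc N)) - ln (1 + real (Suc N))) \<longlonglongrightarrow> 0" by real_asymp
    from tendsto_add[OF LIMSEQ_Suc[OF euler_mascheroni_LIMSEQ] this]
    have "(\<lambda>N. harm (Suc N) - ln (1 + real (Suc N))) \<longlonglongrightarrow> (euler_mascheroni :: real)" by simp
    from tendsto_of_real[OF this, where 'a = complex] show ?thesis by simp
  qed
  have T: "(\<lambda>N. of_nat (Suc N) * stieltjes (real (Suc N)) \<omega>) \<longlonglongrightarrow> 1 / (\<omega> + 1)"
    using \<omega> by (intro LIMSEQ_Suc[OF stieltjes_large]) simp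
  \<comment> \<open>Eliminating the sum of the values \<open>stieltjes n \<omega>\<close> by means
    of \<open>f_val\<close> leaves only quantities whose limits are known.\<close>
  have eq: "(\<Sum>n<Suc N. 1 / (of_nat (Suc n) * (\<omega> + 1)) - stieltjes (real (Suc n)) \<omega>) =
      of_real (harm (Suc N) - ln (1 + real (Suc N))) / (\<omega> + 1) - 1/2 * integral\<^sup>L lborel (f N)
      - of_nat (Suc N) * stieltjes (real (Suc N)) \<omega> / (\<omega> + 1)" for N
  proof -
    have "(\<Sum>n<Suc N. 1 / (of_nat (Suc n) * (\<omega> + 1))) = of_real (harm (Suc N)) / (\<omega> + 1)"
    proof -
      have "harm (Suc N) = (\<Sum>n<Suc N. 1 / real (Suc n))"
        unfolding harm_def by (rule sum.reindex_bij_witness[of _ Suc "\<lambda>n. n - 1"]) (auto simp: inverse_eq_divide)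
      then show ?thesis by (simp add: sum_divide_distrib del: sum.lessThan_Suc of_nat_Suc)
    qed
    moreover have "h / w - S = (h - l) / w - 1/2 * (2 * S - 2 * (l + t) / w) - t / w" for h l t S w :: complex
      by (simp add: add_divide_distrib diff_divide_distrib right_diff_distrib)
    ultimately show ?thesis unfolding sum_subtractf f_val of_real_diff by (simp only:)
  qed
  have "(\<lambda>N. \<Sum>n<Suc N. 1 / (of_nat (Suc n) * (\<omega> + 1)) - stieltjes (real (Suc n)) \<omega>) \<longlonglongrightarrow>
      euler_mascheroni / (\<omega> + 1) - 1/2 * I - 1 / (\<omega> + 1) / (\<omega> + 1)"
    unfolding eq using \<omega>1 by (intro tendsto_intros harm calculation T)
  then have "L = euler_mascheroni / (\<omega> + 1) - 1/2 * I - 1 / (\<omega> + 1) / (\<omega> + 1)"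
    using LIMSEQ_unique LIMSEQ_Suc[OF L(2)] by blast
  moreover have "nu \<omega> = L" unfolding nu_def using L(1) by (rule limI)
  moreover have "convergent (nu_partial \<omega>)" using L(1) by (rule convergentI)
  ultimately show ?thesis using int by (simp add: I_def power2_eq_square)
qed

end
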